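(* Consider the push-based (back-end database driven) caching problem $$\min_{\boldsymbol u}\ \lim_{T\to\infty}\frac1T\int_0^T\sum_{n=1}^N\big[u_n(t)\,c_f+\beta p_n c_a\,\Delta_n(t)\big]\,dt$$ subject to, for all $n\in\{1,\dots,N\}$ and $t\ge0$, $$u_n(t)\in\{0,1\},\qquad \Delta_n(t+dt)=\Delta_n(t)\,(1-u_n(t))+b_n(t).$$ The policy $\boldsymbol u^*$ that solves this problem is given by $$u_n^*(\Delta_n)=\begin{cases}1,&\Delta_n>\eta_n^*,\\0,&\Delta_n\le\eta_n^*,\end{cases}$$ where $$\eta_n^*=\operatorname*{argmin}_{m\in\{\eta_n,\eta_n+1\}}C_n^B(m),\qquad \eta_n=\Big\lfloor\sqrt{2\lambda_nc_f/(\beta p_nc_a)}\Big\rfloor,\qquad C_n^B(m)=\tfrac12\beta p_nc_a(m-1)+\frac{\lambda_nc_f}{m}.$$ Thus $C^{B^*}=\sum_{n=1}^NC_n^B(\eta_n^* )$ is the optimal cost for the push-based caching paradigm. Under the assumption that $\sqrt{2\lambda_nc_f/(\beta p_nc_a)}$ is an integer, the corresponding optimal average cost is $$C^{B^*}=\sum_{n=1}^N\Big[\sqrt{2\lambda_n\beta p_nc_ac_f}-\tfrac12\beta p_nc_a\Big].$$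
   Context: Model (continuous time): $N$ unit-size data items are held at a back-end database and copies are kept in a local edge-cache, with no constraint on the cache size. Requests arrive at the cache according to a Poisson process of rate $\beta\ge0$, and a request targets item $n$ with probability $p_n$, where $(p_n)_{n=1}^N$ is a probability distribution. Item $n$ receives updates at the database according to a Poisson process of rate $\lambda_n\ge0$; $b_n(t)\in\{0,1\}$ equals $1$ if item $n$ receives an update at time $t$ and $0$ otherwise. The age $\Delta_n(t)\in\{0,1,\dots\}$ is the number of updates item $n$ has received at the database since it was most recently cached. The action $u_n(t)=1$ means that the most recent version of item $n$ is fetched to the cache at time $t$, at cost $c_f>0$; $u_n(t)=0$ means it is not fetched. Serving item $n$ from the cache at age $\Delta_n(t)$ costs $c_a\Delta_n(t)$, with $c_a\ge0$. In the push-based paradigm the database controls the cache updates: it observes the ages $\Delta_n(t)$ (the system state) but not the request times, knowing only $\beta$ and $(p_n)$, so that the expected cost at time $t$ for item $n$ is $u_n(t)c_f+\beta p_nc_a\Delta_n(t)$.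
   Formalization: The policy fetches when Δ_n ≥ η_n* rather than Δ_n > η_n* (the strict rule costs C_n^B(η_n*+1)); βp_nc_a ≠ 0 is assumed for every n, m = 0 is excluded from the argmin, and the closed form is stated for λ_n > 0. *)

theory Defs
  imports "HOL-Probability.Probability"
begin

(* Update processes. b t w = 1 iff the item is updated at time t on the sample path w. *)

definition update_count :: "(real \<Rightarrow> 'w \<Rightarrow> nat) \<Rightarrow> real \<Rightarrow> real \<Rightarrow> 'w \<Rightarrow> nat" where
  "update_count b s t \<omega> = card {r \<in> {s<..t}. b r \<omega> = 1}"

(* A Poisson process of rate l relative to the information F: the number of updates in (s,t]
   is known at time t, independent of F s, and Poisson distributed with mean l * (t - s).
   The mass function is written out because poisson_pmf requires a positive rate, whereas
   l = 0 is allowed here. *)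

definition poisson_updates ::
  "'w measure \<Rightarrow> (real \<Rightarrow> 'w measure) \<Rightarrow> real \<Rightarrow> (real \<Rightarrow> 'w \<Rightarrow> nat) \<Rightarrow> bool" where
  "poisson_updates M F l b \<longleftrightarrow>
     (\<forall>\<omega>\<in>space M. \<forall>t. b t \<omega> \<in> {0, 1}) \<and>
     (\<forall>\<omega>\<in>space M. \<forall>t. finite {r \<in> {0<..t}. b r \<omega> = 1}) \<and>
     (\<forall>s t. 0 \<le> s \<and> s \<le> t \<longrightarrow>
        update_count b s t \<in> measurable (F t) (count_space UNIV) \<and>
        prob_space.indep_set M (sets (F s)) {update_count b s t -` K \<inter> space M | K. True} \<and>
        (\<forall>k. measure M {\<omega> \<in> space M. update_count b s t \<omega> = k}
              = (l * (t - s)) ^ k / fact k * exp (- (l * (t - s)))))"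

(* Integrated form of Delta(t + dt) = Delta(t) (1 - u(t)) + b(t): if nothing is fetched
   strictly between s and t, then Delta(t) is Delta(s) (1 - u(s)) plus the number of updates
   in (s,t]. Thus Delta(t) is the age on which the decision u(t) is based: it counts an update
   at time t, but the reset caused by a fetch at time t is visible only after t. *)

definition age_dynamics ::
  "(real \<Rightarrow> 'w \<Rightarrow> nat) \<Rightarrow> nat \<Rightarrow> (real \<Rightarrow> 'w \<Rightarrow> nat) \<Rightarrow> (real \<Rightarrow> 'w \<Rightarrow> nat) \<Rightarrow> 'w \<Rightarrow> bool" where
  "age_dynamics b d0 u \<Delta> \<omega> \<longleftrightarrow>
     \<Delta> 0 \<omega> = d0 \<and>
     (\<forall>s t. 0 \<le> s \<and> s < t \<and> (\<forall>r\<in>{s<..<t}. u r \<omega> = 0) \<longrightarrow>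
        \<Delta> t \<omega> = \<Delta> s \<omega> * (1 - u s \<omega>) + update_count b s t \<omega>)"

definition fetch_times :: "(real \<Rightarrow> 'w \<Rightarrow> nat) \<Rightarrow> real \<Rightarrow> 'w \<Rightarrow> real set" where
  "fetch_times u t \<omega> = {r \<in> {0..t}. u r \<omega> = 1}"

(* A policy u with its ages Delta satisfies the constraints and is non-anticipative: ages,
   decisions and numbers of fetches up to t are F t-measurable. Fetches must not accumulate
   in bounded time; each costs c_f > 0, and the recursion for Delta would not determine the
   ages beyond a point of accumulation. *)

definition push_feasible ::
  "'w measure \<Rightarrow> (real \<Rightarrow> 'w measure) \<Rightarrow> nat \<Rightarrow> (nat \<Rightarrow> real \<Rightarrow> 'w \<Rightarrow> nat) \<Rightarrow> (nat \<Rightarrow> nat) \<Rightarrow>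
   (nat \<Rightarrow> real \<Rightarrow> 'w \<Rightarrow> nat) \<Rightarrow> (nat \<Rightarrow> real \<Rightarrow> 'w \<Rightarrow> nat) \<Rightarrow> bool" where
  "push_feasible M F N b d0 u \<Delta> \<longleftrightarrow> (\<forall>n\<in>{1..N}.
     (\<forall>\<omega>\<in>space M.
        (\<forall>t\<ge>0. u n t \<omega> \<in> {0, 1}) \<and>
        (\<forall>t\<ge>0. finite (fetch_times (u n) t \<omega>)) \<and>
        age_dynamics (b n) (d0 n) (u n) (\<Delta> n) \<omega>) \<and>
     (\<forall>t\<ge>0.
        \<Delta> n t \<in> measurable (F t) (count_space UNIV) \<and>
        u n t \<in> measurable (F t) (count_space UNIV) \<and>
        (\<lambda>\<omega>. card (fetch_times (u n) t \<omega>)) \<in> measurable (F t) (count_space UNIV)))"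

(* Expected cost per unit of time over [0,T]. Fetches are impulses: each one costs c_f, so the
   integral of u(t) c_f over [0,T] means c_f times the number of fetches. *)

definition push_avg_cost ::
  "'w measure \<Rightarrow> nat \<Rightarrow> real \<Rightarrow> (nat \<Rightarrow> real) \<Rightarrow> real \<Rightarrow> real \<Rightarrow>
   (nat \<Rightarrow> real \<Rightarrow> 'w \<Rightarrow> nat) \<Rightarrow> (nat \<Rightarrow> real \<Rightarrow> 'w \<Rightarrow> nat) \<Rightarrow> real \<Rightarrow> ennreal" where
  "push_avg_cost M N \<beta> p c_a c_f u \<Delta> T =
     (\<integral>\<^sup>+ \<omega>. (\<Sum>n=1..N.
         ennreal (c_f * real (card (fetch_times (u n) T \<omega>)))
       + (\<integral>\<^sup>+ t. ennreal (\<beta> * p n * c_a * real (\<Delta> n t \<omega>)) * indicator {0..T} t \<partial>lborel)) \<partial>M)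
     / ennreal T"

(* (u, Delta) solves the minimisation problem with optimal value C. Its own long-run average
   cost is a limit; for the competitors the lower limit is used, so that those whose average
   cost does not converge are covered as well. *)

definition push_solution ::
  "'w measure \<Rightarrow> (real \<Rightarrow> 'w measure) \<Rightarrow> nat \<Rightarrow> (nat \<Rightarrow> real \<Rightarrow> 'w \<Rightarrow> nat) \<Rightarrow> (nat \<Rightarrow> nat) \<Rightarrow>
   real \<Rightarrow> (nat \<Rightarrow> real) \<Rightarrow> real \<Rightarrow> real \<Rightarrow>
   (nat \<Rightarrow> real \<Rightarrow> 'w \<Rightarrow> nat) \<Rightarrow> (nat \<Rightarrow> real \<Rightarrow> 'w \<Rightarrow> nat) \<Rightarrow> real \<Rightarrow> bool" where
  "push_solution M F N b d0 \<beta> p c_a c_f u \<Delta> C \<longleftrightarrow>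
     push_feasible M F N b d0 u \<Delta> \<and>
     ((push_avg_cost M N \<beta> p c_a c_f u \<Delta>) \<longlongrightarrow> ennreal C) at_top \<and>
     (\<forall>u' \<Delta>'. push_feasible M F N b d0 u' \<Delta>' \<longrightarrow>
        ennreal C \<le> Liminf at_top (push_avg_cost M N \<beta> p c_a c_f u' \<Delta>'))"

(* The feedback law: fetch item n as soon as its age reaches the threshold m n, so that a fetch
   cycle visits the ages 0, ..., m n - 1 and costs c_B on average. The law written with a strict
   inequality, "fetch iff the age exceeds m", is the one below for m + 1: its cycles visit
   0, ..., m and its average cost is c_B at m + 1, not at m. For example, for one item with
   lam = c_f = beta = p = 1 and c_a = 2 the minimiser of c_B is m = 1 with c_B = 1, whereas
   fetching iff the age exceeds 1 costs 3/2. Hence the non-strict inequality. *)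

definition follows_threshold ::
  "'w measure \<Rightarrow> nat \<Rightarrow> (nat \<Rightarrow> nat) \<Rightarrow>
   (nat \<Rightarrow> real \<Rightarrow> 'w \<Rightarrow> nat) \<Rightarrow> (nat \<Rightarrow> real \<Rightarrow> 'w \<Rightarrow> nat) \<Rightarrow> bool" where
  "follows_threshold M N m u \<Delta> \<longleftrightarrow>
     (\<forall>n\<in>{1..N}. \<forall>t\<ge>0. \<forall>\<omega>\<in>space M. u n t \<omega> = (if \<Delta> n t \<omega> \<ge> m n then 1 else 0))"

(* The arguments l and h stand for lambda_n and beta * p_n * c_a. *)

definition c_B :: "real \<Rightarrow> real \<Rightarrow> real \<Rightarrow> nat \<Rightarrow> real" where
  "c_B l h c_f m = 1/2 * h * (real m - 1) + l * c_f / real m"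

definition eta :: "real \<Rightarrow> real \<Rightarrow> real \<Rightarrow> nat" where
  "eta l h c_f = nat \<lfloor>sqrt (2 * l * c_f / h)\<rfloor>"

(* m is a minimiser of c_B over {eta, eta + 1}. If eta = 0, then c_B has a pole at 0 (while
   division by 0 yields 0 in HOL), so 0 is not a candidate. *)

definition is_eta_star :: "real \<Rightarrow> real \<Rightarrow> real \<Rightarrow> nat \<Rightarrow> bool" where
  "is_eta_star l h c_f m \<longleftrightarrow>
     is_arg_min (c_B l h c_f) (\<lambda>k. k \<in> {eta l h c_f, eta l h c_f + 1} \<and> k > 0) m"

end

theory Submission
  imports Defs
begin

text \<open>
  The costs of the items separate, so each item is treated on its own, with holding cost \<open>h = \<beta> p\<^sub>n c\<^sub>a\<close>,
  update rate \<open>l\<close>, threshold \<open>m\<close> and average cost \<open>C = c_B l h c m\<close>. The proof is a verification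
  argument. There is a function \<open>V\<close> with \<open>0 \<le> V \<le> c\<close>, \<open>V 0 = 0\<close>, \<open>V k = c\<close> for \<open>k \<ge> m\<close>, and
  \<open>l (V (k + 1) - V k) \<ge> C - h k\<close>, with equality for \<open>k < m\<close>. Between \<open>s\<close> and \<open>t\<close> the quantity
  \<open>V (age) + c \<cdot> (number of fetches)\<close> increases under every policy by at least \<open>V (x + D) - V x\<close>, where \<open>x\<close> is
  the age just after \<open>s\<close> and \<open>D\<close> the number of updates in \<open>(s, t]\<close>: without a fetch the age becomes
  \<open>x + D\<close>, and a single fetch already pays \<open>c \<ge> V (x + D)\<close>. Since \<open>D\<close> is independent of the past and Poisson
  distributed, summing over a grid and refining it gives \<open>C T \<le> E (cost up to T) + c\<close>.
  Under the threshold policy these inequalities are equalities up to terms of order \<open>D (D - 1)\<close>,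
  which yields \<open>E (cost up to T) \<le> C T + 2 c\<close>.
\<close>

subsection \<open>The relative value function\<close>

text \<open>For \<open>l = 0\<close> the last term is \<open>0\<close> by the convention \<open>x / 0 = 0\<close>; this is harmless because then \<open>m = 1\<close>.\<close>

definition rel_value :: "real \<Rightarrow> real \<Rightarrow> real \<Rightarrow> nat \<Rightarrow> nat \<Rightarrow> real" where
  "rel_value l h c m k =
     c * real (min k m) / real m + h * real (min k m) * (real m - real (min k m)) / (2 * l)"

lemma is_eta_star_pos: "is_eta_star l h c m \<Longrightarrow> m > 0"
  by (auto simp: is_eta_star_def is_arg_min_def)

text \<open>For \<open>k > 0\<close> the increment \<open>c_B (k + 1) - c_B k\<close> has the sign
  of \<open>k * (k + 1) - 2 * l * c / h\<close>. Minimality over the two candidates gives one bound,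
  the rounding in \<open>eta\<close> the other. \<open>rel_value_bounds\<close> and
  \<open>c_B_le\<close> each rest on one of these discrete first-order conditions.\<close>

lemma is_eta_star_bounds:
  assumes eta: "is_eta_star l h c m" and "l \<ge> 0" "h > 0" "c > 0"
  shows "h * real m * (real m - 1) \<le> 2 * l * c" "2 * l * c \<le> h * real m * (real m + 1)"
proof -
  define x where "x = 2 * l * c / h"
  have x: "2 * l * c = x * h" "x \<ge> 0" using assms by (auto simp: x_def)
  define e where "e = eta l h c"
  have "real e \<le> sqrt x" "sqrt x < real e + 1"
    using \<open>x \<ge> 0\<close> by (auto simp: e_def eta_def x_def)
  then have "(real e)\<^sup>2 \<le> (sqrt x)\<^sup>2" "(sqrt x)\<^sup>2 < (real e + 1)\<^sup>2"
    using \<open>x \<ge> 0\<close> by (auto intro!: power_mono power_strict_mono simp del: real_sqrt_pow2)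
  then have e: "real e * real e \<le> x" "x < (real e + 1) * (real e + 1)"
    using \<open>x \<ge> 0\<close> by (auto simp: power2_eq_square)
  have m: "m = e \<or> m = e + 1" "m > 0"
    and min: "\<And>k. k = e \<or> k = e + 1 \<Longrightarrow> k > 0 \<Longrightarrow> c_B l h c m \<le> c_B l h c k"
    using eta by (auto simp: is_eta_star_def is_arg_min_def e_def not_less)
  have diff: "c_B l h c (k + 1) - c_B l h c k = h / 2 * (1 - x / (real k * (real k + 1)))"
    if "k > 0" for k
  proof -
    have lc: "l * c = x * h / 2" using x by simp
    have "l * c / real (k + 1) - l * c / real k = - (l * c) / (real k * (real k + 1))"
      using that by (simp add: divide_simps) (simp add: algebra_simps)
    moreover have "1/2 * h * (real (k + 1) - 1) = 1/2 * h * (real k - 1) + h / 2"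
      by (simp add: right_diff_distrib diff_divide_distrib)
    moreover have "- (l * c) / (real k * (real k + 1)) = - (h / 2 * (x / (real k * (real k + 1))))"
      by (simp add: lc)
    ultimately show ?thesis by (simp add: c_B_def right_diff_distrib)
  qed
  have "real m * (real m - 1) \<le> x \<and> x \<le> real m * (real m + 1)"
  proof (cases "m = e")
    case True
    with m min[of "e + 1"] diff[of e] have "0 \<le> h / 2 * (1 - x / (real e * (real e + 1)))"
      by auto
    then have "x / (real e * (real e + 1)) \<le> 1" using \<open>h > 0\<close>
      by (simp add: zero_le_mult_iff)
    then have "x \<le> real e * (real e + 1)" using True m by (simp add: divide_le_eq split: if_splits)
    moreover have "real m * (real m - 1) \<le> real e * real e"
      using True by (simp add: mult_left_mono)
    ultimately show ?thesis using True e by auto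
  next
    case False
    then have me: "m = e + 1" using m by simp
    have "real e * (real e + 1) \<le> x"
    \<comment> \<open>For \<open>e = 0\<close> the candidate \<open>e\<close> is excluded and offers
      no comparison, but the left side is then 0.\<close>
    proof (cases "e = 0")
      case False
      with me min[of e] diff[of e] have "0 \<ge> h / 2 * (1 - x / (real e * (real e + 1)))"
        by auto
      then have "x / (real e * (real e + 1)) \<ge> 1" using \<open>h > 0\<close>
        by (simp add: mult_le_0_iff)
      then show ?thesis using False by (simp add: le_divide_eq split: if_splits)
    qed (use \<open>x \<ge> 0\<close> in auto)
    moreover have "(real e + 1) * (real e + 1) \<le> real m * (real m + 1)"
      using me by (intro mult_mono) auto
    ultimately show ?thesis using e me by (auto simp: algebra_simps)
  qed
  then have "h * (real m * (real m - 1)) \<le> h * x" "h * x \<le> h * (real m * (real m + 1))"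
    using \<open>h > 0\<close> by auto
  then show "h * real m * (real m - 1) \<le> 2 * l * c" "2 * l * c \<le> h * real m * (real m + 1)"
    using x by (auto simp: mult_ac)
qed

lemma is_eta_star_zero_rate: "is_eta_star 0 h c m \<Longrightarrow> m = 1"
  by (auto simp: is_eta_star_def is_arg_min_def eta_def)

lemma c_B_nonneg: "l \<ge> 0 \<Longrightarrow> h > 0 \<Longrightarrow> c > 0 \<Longrightarrow> m > 0 \<Longrightarrow> c_B l h c m \<ge> 0"
  by (simp add: c_B_def)

text \<open>The second bound on \<open>m\<close> says
  \<open>l * c / m \<le> h * (m + 1) / 2\<close>, and adding \<open>h * (m - 1) / 2\<close> gives
  \<open>h * m\<close>. So from age \<open>m\<close> on the running cost is at least the average
  cost, which yields the drift inequality where \<open>rel_value\<close> is constant.\<close>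

lemma c_B_le:
  assumes "is_eta_star l h c m" "l \<ge> 0" "h > 0" "c > 0" "m \<le> k"
  shows "c_B l h c m \<le> h * real k"
proof -
  have "m > 0" using assms is_eta_star_pos by auto
  have "l * c \<le> (h * (real m + 1) / 2) * real m"
    using is_eta_star_bounds(2)[OF assms(1-4)] by (simp add: algebra_simps)
  then have "l * c / real m \<le> h * (real m + 1) / 2"
    using \<open>m > 0\<close> by (simp add: divide_le_eq)
  then have "c_B l h c m \<le> 1/2 * h * (real m - 1) + h * (real m + 1) / 2"
    unfolding c_B_def by linarith
  also have "\<dots> = h * real m" by (simp add: field_simps)
  also have "\<dots> \<le> h * real k" using assms by auto
  finally show ?thesis .
qed

lemma rel_value_simps:
  assumes "m > 0"
  shows "rel_value l h c m 0 = 0" "m \<le> k \<Longrightarrow> rel_value l h c m k = c"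
  using assms by (auto simp: rel_value_def)

text \<open>For \<open>k < m\<close> the gap \<open>c - rel_value l h c m k\<close> factors as
  \<open>(m - k) * (c / m - h * k / (2 * l))\<close>. The second factor is nonnegative by the first
  bound on \<open>m\<close>, because \<open>k \<le> m - 1\<close>.\<close>

lemma rel_value_bounds:
  assumes "is_eta_star l h c m" "l \<ge> 0" "h > 0" "c > 0"
  shows "0 \<le> rel_value l h c m k" "rel_value l h c m k \<le> c"
proof -
  have m: "m > 0" using assms is_eta_star_pos by auto
  show "0 \<le> rel_value l h c m k"
    unfolding rel_value_def using assms m by (intro add_nonneg_nonneg divide_nonneg_nonneg mult_nonneg_nonneg) auto
  show "rel_value l h c m k \<le> c"
  proof (cases "m \<le> k")
    case True
    then show ?thesis using m by (simp add: rel_value_simps)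
  next
    case False
    have "h * real k / (2 * l) \<le> c / real m"
    \<comment> \<open>For \<open>l = 0\<close> the left side is 0 by the convention on
      division.\<close>
    proof (cases "l = 0")
      case False
      have "h * real m * real k \<le> h * real m * (real m - 1)"
        using \<open>\<not> m \<le> k\<close> assms by (intro mult_left_mono) auto
      also have "\<dots> \<le> 2 * l * c" using is_eta_star_bounds[OF assms] by auto
      finally show ?thesis using m False assms by (simp add: field_simps)
    qed (use assms in auto)
    then have "0 \<le> (real m - real k) * (c / real m - h * real k / (2 * l))"
      using False by auto
    also have "\<dots> = c - rel_value l h c m k"
    proof -
      have "c / real m * real m = c" using m by simp
      then have "c = c / real m * (real m - real k) + c / real m * real k"
        by (simp add: algebra_simps)
      moreover have "rel_value l h c m k = c / real m * real k + h * real k / (2 * l) * (real m - real k)"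
        using False by (simp add: rel_value_def min_def)
      ultimately show ?thesis by (simp add: algebra_simps)
    qed
    finally show ?thesis by simp
  qed
qed

text \<open>This is the average-cost Bellman equation below the threshold: the age jumps from
  \<open>k\<close> to \<open>k + 1\<close> at rate \<open>l\<close>, so the left side is the
  generator of the age process without fetches, applied to \<open>rel_value\<close>. The quadratic
  term of \<open>rel_value\<close> is chosen so that its differences produce
  \<open>- h * k\<close>.\<close>

lemma rel_value_drift:
  assumes "is_eta_star l h c m"
  shows "l * (rel_value l h c m (Suc k) - rel_value l h c m k) =
    (if k < m then c_B l h c m - h * real k else 0)"
proof (cases "k < m")
  case k: True
  have "rel_value l h c m (Suc k) - rel_value l h c m k
      = c / real m + h * (real m - 2 * real k - 1) / (2 * l)"
  proof -
    have "c * real (Suc k) / real m - c * real k / real m = c / real m"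
      by (simp add: diff_divide_distrib[symmetric] algebra_simps)
    moreover have "h * real (Suc k) * (real m - real (Suc k)) / (2 * l) - h * real k * (real m - real k) / (2 * l)
        = h * (real m - 2 * real k - 1) / (2 * l)"
      unfolding diff_divide_distrib[symmetric] by (simp add: algebra_simps)
    moreover have "min (Suc k) m = Suc k" "min k m = k" using k by auto
    ultimately show ?thesis unfolding rel_value_def by linarith
  qed
  \<comment> \<open>Cancelling \<open>l\<close> is correct even for \<open>l = 0\<close>: then
    \<open>m = 1\<close> and \<open>k = 0\<close>, so \<open>m - 2 * k - 1\<close> vanishes.\<close>
  moreover have "l * (h * (real m - 2 * real k - 1) / (2 * l)) = h * (real m - 2 * real k - 1) / 2"
    using k is_eta_star_zero_rate[of h c m] assms by (cases "l = 0") auto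
  ultimately have "l * (rel_value l h c m (Suc k) - rel_value l h c m k) =
      l * c / real m + h * (real m - 2 * real k - 1) / 2"
    by (simp add: distrib_left)
  also have "\<dots> = c_B l h c m - h * real k"
    by (simp add: c_B_def right_diff_distrib distrib_left add_divide_distrib diff_divide_distrib)
  finally show ?thesis using k by simp
qed (auto simp: rel_value_def min_def)

text \<open>If the root is an integer \<open>k\<close>, the candidates are \<open>k\<close> and
  \<open>k + 1\<close>, and the first bound on \<open>m\<close> rules out \<open>k + 1\<close>, as
  it would give \<open>(k + 1) * k \<le> k * k\<close>. At \<open>m = k\<close> the fetching term
  equals \<open>h * k / 2\<close>, so \<open>c_B\<close> adds up to
  \<open>h * k - h / 2\<close>.\<close>

lemma c_B_integer_sqrt:
  assumes eta: "is_eta_star l h c m" and "l > 0" "h > 0" "c > 0" "sqrt (2 * l * c / h) \<in> \<int>"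
  shows "c_B l h c m = sqrt (2 * l * h * c) - 1/2 * h"
proof -
  obtain i where i: "sqrt (2 * l * c / h) = of_int i" using assms by (auto elim: Ints_cases)
  have "sqrt (2 * l * c / h) > 0" using assms by simp
  then have "i > 0" using i by simp
  define k where "k = nat i"
  have k: "sqrt (2 * l * c / h) = real k" "k > 0" using i \<open>i > 0\<close> by (auto simp: k_def)
  then have "2 * l * c / h = (real k)\<^sup>2" using assms
    by (metis real_sqrt_pow2 less_imp_le divide_pos_pos mult_pos_pos zero_less_numeral)
  then have lc: "2 * l * c = h * (real k)\<^sup>2" using assms by (simp add: field_simps)
  have "eta l h c = k" using k by (simp add: eta_def)
  then have "m = k \<or> m = k + 1" using eta by (auto simp: is_eta_star_def is_arg_min_def)
  moreover have "m \<noteq> k + 1"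
  proof
    assume m: "m = k + 1"
    have "h * real m * (real m - 1) \<le> h * (real k)\<^sup>2"
      using is_eta_star_bounds[OF eta] assms lc by auto
    then have "real m * (real m - 1) \<le> (real k)\<^sup>2" using assms by (simp add: mult.assoc)
    then show False using m k by (simp add: power2_eq_square algebra_simps)
  qed
  ultimately have m: "m = k" by simp
  have "2 * l * h * c = (h * real k)\<^sup>2" using lc by (simp add: power2_eq_square mult_ac)
  then have "sqrt (2 * l * h * c) = h * real k" using assms by simp
  moreover have "l * c / real k = h * real k / 2" using lc k by (simp add: field_simps power2_eq_square)
  moreover have "c_B l h c m = 1/2 * h * (real k - 1) + l * c / real k"
    by (simp add: c_B_def m)
  moreover have "1/2 * h * (real k - 1) = h * real k / 2 - 1/2 * h"
    by (simp add: right_diff_distrib diff_divide_distrib)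
  ultimately show ?thesis by linarith
qed

subsection \<open>Sample paths\<close>

text \<open>The age just after the decision at time \<open>t\<close>, which differs from \<open>\<Delta> t\<close> only at fetch times.\<close>

definition residual_age :: "(real \<Rightarrow> 'w \<Rightarrow> nat) \<Rightarrow> (real \<Rightarrow> 'w \<Rightarrow> nat) \<Rightarrow> real \<Rightarrow> 'w \<Rightarrow> nat" where
  "residual_age u \<Delta> t \<omega> = \<Delta> t \<omega> * (1 - u t \<omega>)"

lemma update_count_add:
  assumes "finite {r \<in> {0<..t}. b r \<omega> = 1}" "0 \<le> s" "s \<le> r" "r \<le> t"
  shows "update_count b s t \<omega> = update_count b s r \<omega> + update_count b r t \<omega>"
proof -
  have "{x \<in> {s<..t}. b x \<omega> = 1} = {x \<in> {s<..r}. b x \<omega> = 1} \<union> {x \<in> {r<..t}. b x \<omega> = 1}"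
    using assms by auto
  moreover have "finite {x \<in> {s<..r}. b x \<omega> = 1}" "finite {x \<in> {r<..t}. b x \<omega> = 1}"
    using assms by (auto intro: finite_subset[OF _ assms(1)])
  ultimately show ?thesis unfolding update_count_def by (simp add: card_Un_disjoint disjoint_iff)
qed

text \<open>Facts about a single outcome are deterministic and are collected here; the locale is
  later interpreted at each outcome of the sample space.\<close>

locale age_path =
  fixes b u \<Delta> :: "real \<Rightarrow> 'w \<Rightarrow> nat" and d0 :: nat and \<omega> :: 'w
  assumes updates: "\<And>t. finite {r \<in> {0<..t}. b r \<omega> = 1}"
    and fetch: "\<And>t. t \<ge> 0 \<Longrightarrow> u t \<omega> \<in> {0, 1}"
    and finite_fetch: "\<And>t. t \<ge> 0 \<Longrightarrow> finite (fetch_times u t \<omega>)"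
    and dynamics: "age_dynamics b d0 u \<Delta> \<omega>"
begin

abbreviation "age t \<equiv> residual_age u \<Delta> t \<omega>"
abbreviation "nfetch s t \<equiv> card {r \<in> {s<..t}. u r \<omega> = 1}"

lemma update_count_split:
  "0 \<le> s \<Longrightarrow> s \<le> r \<Longrightarrow> r \<le> t \<Longrightarrow>
    update_count b s t \<omega> = update_count b s r \<omega> + update_count b r t \<omega>"
  using update_count_add[where b=b and \<omega>=\<omega> and s=s and r=r and t=t] updates[of t] by blast

lemma finite_fetch_interval: "0 \<le> s \<Longrightarrow> finite {r \<in> {s<..t}. u r \<omega> = 1}"
  by (cases "t \<ge> 0") (auto simp: fetch_times_def intro: finite_subset[OF _ finite_fetch[of t]])

lemma card_fetch_times:
  assumes "0 \<le> s" "s \<le> t"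
  shows "card (fetch_times u t \<omega>) = card (fetch_times u s \<omega>) + nfetch s t"
proof -
  have "fetch_times u t \<omega> = fetch_times u s \<omega> \<union> {r \<in> {s<..t}. u r \<omega> = 1}"
    using assms by (auto simp: fetch_times_def)
  then show ?thesis using finite_fetch[of s] finite_fetch_interval[of s t] assms
    by (simp add: card_Un_disjoint disjoint_iff fetch_times_def)
qed

text \<open>Only the open interval must be free of fetches: a fetch at \<open>s\<close> is already
  absorbed in \<open>age s\<close>, and a fetch at \<open>t\<close> becomes visible only after
  \<open>t\<close>.\<close>

lemma \<Delta>_eq:
  "0 \<le> s \<Longrightarrow> s < t \<Longrightarrow> (\<And>r. s < r \<Longrightarrow> r < t \<Longrightarrow> u r \<omega> \<noteq> 1) \<Longrightarrow> \<Delta> t \<omega> = age s + update_count b s t \<omega>"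
proof -
  assume st: "0 \<le> s" "s < t" "\<And>r. s < r \<Longrightarrow> r < t \<Longrightarrow> u r \<omega> \<noteq> 1"
  have "u r \<omega> = 0" if "r \<in> {s<..<t}" for r
    using fetch[of r] st that by auto
  then show ?thesis using dynamics st(1,2) unfolding age_dynamics_def residual_age_def by blast
qed

lemma residual_age_no_fetch:
  assumes "0 \<le> s" "s \<le> t" "\<And>r. s < r \<Longrightarrow> r \<le> t \<Longrightarrow> u r \<omega> \<noteq> 1"
  shows "age t = age s + update_count b s t \<omega>"
proof (cases "s = t")
  case False
  then have "u t \<omega> = 0" using assms fetch[of t] by auto
  then have "age t = \<Delta> t \<omega>" by (simp add: residual_age_def)
  then show ?thesis using \<Delta>_eq[of s t] assms False by auto
qed (simp add: update_count_def)

lemma nfetch_eq_0D: "0 \<le> s \<Longrightarrow> nfetch s t = 0 \<Longrightarrow> s < r \<Longrightarrow> r \<le> t \<Longrightarrow> u r \<omega> \<noteq> 1"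
  using finite_fetch_interval[of s t] by auto

lemma value_increase:
  fixes V :: "nat \<Rightarrow> real"
  assumes "0 \<le> s" "s \<le> t" "\<And>k. V k \<ge> 0" "\<And>k. V k \<le> c"
  shows "V (age t) + c * real (nfetch s t) \<ge> V (age s + update_count b s t \<omega>)"
proof (cases "nfetch s t = 0")
  case True
  then show ?thesis using residual_age_no_fetch[OF assms(1,2)] nfetch_eq_0D[OF assms(1) True] by simp
next
  case False
  have "c \<ge> 0" using assms(3,4) order_trans by blast
  then have "c * 1 \<le> c * real (nfetch s t)" using False by (intro mult_left_mono) auto
  then show ?thesis using assms(3)[of "age t"] assms(4)[of "age s + update_count b s t \<omega>"] by linarith
qed

text \<open>The finitely many updates and fetches up to \<open>t\<close> leave a gap before
  \<open>t\<close> unless one of them occurs at \<open>t\<close> itself. Left neighbourhoods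
  suffice, since the grid sums below evaluate at left end points.\<close>

lemma locally_constant:
  assumes t: "0 < t" "b t \<omega> \<noteq> 1" "u t \<omega> \<noteq> 1"
  obtains e where "e > 0" "\<And>s. t - e < s \<Longrightarrow> s \<le> t \<Longrightarrow> 0 \<le> s \<Longrightarrow> age s = age t"
proof -
  \<comment> \<open>The point 0 makes \<open>B\<close> nonempty, so that \<open>Max B\<close> is
    meaningful.\<close>
  define B where "B = {0} \<union> {r \<in> {0<..t}. b r \<omega> = 1} \<union> {r \<in> {0<..t}. u r \<omega> = 1}"
  have B: "finite B" "B \<noteq> {}" unfolding B_def using updates finite_fetch_interval[of 0 t] by auto
  have "t \<notin> B" using t by (auto simp: B_def)
  moreover have "r \<le> t" if "r \<in> B" for r using that t(1) by (auto simp: B_def)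
  ultimately have "\<And>r. r \<in> B \<Longrightarrow> r < t" using less_le by blast
  then have "Max B < t" using B by simp
  show ?thesis
  proof
    show "t - Max B > 0" using \<open>Max B < t\<close> by simp
    fix s assume s: "t - (t - Max B) < s" "s \<le> t" "0 \<le> s"
    have "r \<notin> B" if "s < r" for r
      using Max_ge[OF B(1), of r] that s by auto
    then have "{r \<in> {s<..t}. b r \<omega> = 1} = {}" and "\<And>r. s < r \<Longrightarrow> r \<le> t \<Longrightarrow> u r \<omega> \<noteq> 1"
      using s by (auto simp: B_def)
    moreover from this have "update_count b s t \<omega> = 0"
      unfolding update_count_def by (simp only: card.empty)
    ultimately show "age s = age t" using residual_age_no_fetch[of s t] s by simp
  qed
qed

text \<open>Look back to the last fetch in \<open>(0, t]\<close>, or to time 0 if there is none: the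
  residual age there is at most \<open>d0\<close> and then grows only by updates. The bound does not
  depend on the policy and later dominates the total age.\<close>

lemma residual_age_le: "0 \<le> t \<Longrightarrow> age t \<le> d0 + update_count b 0 t \<omega>"
proof -
  assume t: "0 \<le> t"
  define B where "B = {0} \<union> {r \<in> {0<..t}. u r \<omega> = 1}"
  have B: "finite B" "B \<noteq> {}" unfolding B_def using finite_fetch_interval[of 0 t] by auto
  define r where "r = Max B"
  have r: "r \<in> B" "\<And>x. x \<in> B \<Longrightarrow> x \<le> r" using B by (auto simp: r_def)
  have "0 \<le> r" "r \<le> t" using r t by (auto simp: B_def)
  have "age t = age r + update_count b r t \<omega>"
  proof (rule residual_age_no_fetch)
    fix x assume "r < x" "x \<le> t"
    then show "u x \<omega> \<noteq> 1" using r(2)[of x] \<open>0 \<le> r\<close> by (auto simp: B_def)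
  qed fact+
  moreover have "age r \<le> d0"
    using r dynamics by (auto simp: B_def residual_age_def age_dynamics_def)
  moreover have "update_count b r t \<omega> \<le> update_count b 0 t \<omega>"
    using update_count_split[OF order.refl \<open>0 \<le> r\<close> \<open>r \<le> t\<close>] by linarith
  ultimately show ?thesis by simp
qed

end

locale threshold_path = age_path +
  fixes m :: nat
  assumes m_pos: "m > 0"
    and threshold: "\<And>t. t \<ge> 0 \<Longrightarrow> u t \<omega> = (if \<Delta> t \<omega> \<ge> m then 1 else 0)"
begin

lemma residual_age_less: "t \<ge> 0 \<Longrightarrow> age t < m"
  using threshold[of t] m_pos by (auto simp: residual_age_def)

text \<open>Induction that splits off the first fetch after \<open>s\<close>. Each fetch discards an
  age of at least \<open>m\<close>, which must come from \<open>age s\<close> and the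
  updates.\<close>

lemma fetch_balance:
  "0 \<le> s \<Longrightarrow> s \<le> t \<Longrightarrow> m * nfetch s t + age t \<le> age s + update_count b s t \<omega>"
proof (induction "nfetch s t" arbitrary: s)
  case 0
  then show ?case using residual_age_no_fetch[of s t] nfetch_eq_0D[of s t] by simp
next
  case (Suc n)
  let ?S = "\<lambda>s. {r \<in> {s<..t}. u r \<omega> = 1}"
  have S: "finite (?S s)" "?S s \<noteq> {}"
    using Suc.hyps(2) Suc.prems finite_fetch_interval[of s t] by (auto simp del: Collect_empty_eq)
  define r where "r = Min (?S s)"
  have r: "r \<in> ?S s" "\<And>x. x \<in> ?S s \<Longrightarrow> r \<le> x" using S Min_in[OF S] by (auto simp: r_def)
  have "?S s = insert r (?S r)" using r by force
  moreover have "finite (?S r)" using S r by (auto intro: finite_subset[OF _ S(1)])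
  ultimately have nfetch: "nfetch s t = Suc (nfetch r t)" by simp
  have "\<Delta> r \<omega> = age s + update_count b s r \<omega>"
  proof (rule \<Delta>_eq)
    fix x assume "s < x" "x < r"
    then show "u x \<omega> \<noteq> 1" using r(1) r(2)[of x] by auto
  qed (use r Suc.prems in auto)
  moreover have "\<Delta> r \<omega> \<ge> m"
  proof -
    have "u r \<omega> = 1" "r \<ge> 0" using r Suc.prems by auto
    then show ?thesis using threshold[of r] by presburger
  qed
  moreover have "age r = 0" using r by (simp add: residual_age_def)
  moreover have "m * nfetch r t + age t \<le> age r + update_count b r t \<omega>"
  proof (rule Suc.hyps(1))
    show "n = nfetch r t" using Suc.hyps(2) nfetch by linarith
  qed (use r Suc.prems in auto)
  moreover have "update_count b s t \<omega> = update_count b s r \<omega> + update_count b r t \<omega>"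
    using r Suc.prems by (intro update_count_split) auto
  ultimately show ?case unfolding nfetch by simp
qed

text \<open>With \<open>D\<close> updates, \<open>D + 1\<close> fetches would require
  \<open>m * (D + 1) \<le> age s + D\<close>, which is impossible as \<open>age s < m\<close> and
  \<open>D \<le> m * D\<close>.\<close>

lemma fetches_le_updates: "0 \<le> s \<Longrightarrow> s \<le> t \<Longrightarrow> nfetch s t \<le> update_count b s t \<omega>"
proof (rule ccontr)
  assume st: "0 \<le> s" "s \<le> t" and "\<not> nfetch s t \<le> update_count b s t \<omega>"
  then have "m * (update_count b s t \<omega> + 1) \<le> m * nfetch s t" by (intro mult_le_mono) auto
  moreover have "update_count b s t \<omega> \<le> m * update_count b s t \<omega>" using m_pos by simp
  ultimately show False using fetch_balance[OF st] residual_age_less[OF st(1)]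
    unfolding distrib_left mult_1_right by linarith
qed

text \<open>One update allows at most one fetch, and if there is one, \<open>fetch_balance\<close>
  forces \<open>age s + 1 = m\<close> and \<open>age t = 0\<close>, so both sides equal
  \<open>c\<close>. Thus \<open>value_increase\<close> is tight under the threshold policy unless
  two or more updates fall into the step.\<close>

lemma value_increase_eq:
  fixes V :: "nat \<Rightarrow> real"
  assumes st: "0 \<le> s" "s \<le> t" and V: "V 0 = 0" "V m = c" and D: "update_count b s t \<omega> \<le> 1"
  shows "V (age t) + c * real (nfetch s t) = V (age s + update_count b s t \<omega>)"
proof (cases "nfetch s t = 0")
  case True
  have "age t = age s + update_count b s t \<omega>"
    by (rule residual_age_no_fetch[OF st]) (rule nfetch_eq_0D[OF st(1) True])
  then show ?thesis unfolding True by simp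
next
  case False
  then have nfetch: "nfetch s t = 1" "update_count b s t \<omega> = 1" using fetches_le_updates[OF st] D by linarith+
  have "age t = 0" "age s + 1 = m"
    using fetch_balance[OF st] residual_age_less[OF st(1)] unfolding nfetch by linarith+
  then show ?thesis using V unfolding nfetch by simp
qed

end

subsection \<open>Riemann sums of piecewise constant functions\<close>

text \<open>The step functions that freeze \<open>g\<close> at the left end of each grid cell are
  bounded by \<open>B\<close> and converge off a finite set, since the left end eventually falls
  into the window where \<open>g\<close> is constant. Dominated convergence gives both claims;
  measurability of \<open>g\<close> comes out along the way.\<close>

lemma left_Riemann_sums:
  fixes g :: "real \<Rightarrow> real"
  assumes T: "T > 0" and S: "finite S"
    and bound: "\<And>t. 0 \<le> t \<Longrightarrow> t \<le> T \<Longrightarrow> \<bar>g t\<bar> \<le> B"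
    and left: "\<And>t. 0 < t \<Longrightarrow> t \<le> T \<Longrightarrow> t \<notin> S \<Longrightarrow> \<exists>e>0. \<forall>s. t - e < s \<and> s \<le> t \<and> 0 \<le> s \<longrightarrow> g s = g t"
  shows "integrable lborel (\<lambda>t. g t * indicator {0..T} t)"
    and "(\<lambda>n. \<Sum>i<Suc n. T / Suc n * g (real i * (T / Suc n))) \<longlonglongrightarrow> (LINT t|lborel. g t * indicator {0..T} t)"
proof -
  define d where "d n = T / real (Suc n)" for n
  have d: "d n > 0" "d n * real (Suc n) = T" for n using T by (auto simp: d_def)
  define a where "a n t = (\<Sum>i<Suc n. g (real i * d n) * indicator {real i * d n..<real (Suc i) * d n} t)" for n and t :: real
  have floor: "t \<in> {real i * d n..<real (Suc i) * d n} \<longleftrightarrow> i = nat \<lfloor>t / d n\<rfloor>" if "0 \<le> t" for t n i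
  proof -
    have "t \<in> {real i * d n..<real (Suc i) * d n} \<longleftrightarrow> real i \<le> t / d n \<and> t / d n < real i + 1"
      using d(1)[of n] by (simp add: field_simps)
    also have "\<dots> \<longleftrightarrow> \<lfloor>t / d n\<rfloor> = int i" by (simp add: floor_eq_iff)
    also have "\<dots> \<longleftrightarrow> i = nat \<lfloor>t / d n\<rfloor>"
      using that d(1)[of n] by (auto simp: less_imp_le)
    finally show ?thesis .
  qed
  have a_eq: "a n t = g (real (nat \<lfloor>t / d n\<rfloor>) * d n)" if t: "0 \<le> t" "t < T" for n t
  proof -
    have "t / d n < real (Suc n)" using t d[of n] by (simp add: divide_less_eq mult.commute)
    then have "nat \<lfloor>t / d n\<rfloor> < Suc n" using t d(1)[of n]
      by (metis floor_less_iff nat_less_iff of_int_of_nat_eq zero_le_floor divide_nonneg_pos)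
    moreover have "a n t = (\<Sum>i<Suc n. if i = nat \<lfloor>t / d n\<rfloor> then g (real i * d n) else 0)"
      unfolding a_def using floor[OF t(1)] by (intro sum.cong) (auto simp: indicator_def)
    ultimately show ?thesis by (simp add: sum.delta)
  qed
  \<comment> \<open>The product is the left end of the grid cell that contains
    \<open>t\<close>.\<close>
  have left_end: "0 \<le> real (nat \<lfloor>t / d n\<rfloor>) * d n" "real (nat \<lfloor>t / d n\<rfloor>) * d n \<le> t"
      "t - d n < real (nat \<lfloor>t / d n\<rfloor>) * d n" if "0 \<le> t" for t n
    using floor[OF that, of "nat \<lfloor>t / d n\<rfloor>" n] d(1)[of n] by (auto simp: algebra_simps)
  have a_out: "a n t = 0" if t: "t < 0 \<or> t \<ge> T" for n t
  proof -
    have "t \<notin> {real i * d n..<real (Suc i) * d n}" if "i < Suc n" for i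
    proof
      assume i: "t \<in> {real i * d n..<real (Suc i) * d n}"
      have "real (Suc i) * d n \<le> real (Suc n) * d n"
        using that d(1)[of n] by (intro mult_right_mono) auto
      moreover have "0 \<le> real i * d n" using d(1)[of n] by auto
      ultimately show False using i t d(2)[of n] by (simp add: mult.commute)
    qed
    then show ?thesis unfolding a_def by (intro sum.neutral) auto
  qed
  have d0: "d \<longlonglongrightarrow> 0" unfolding d_def by real_asymp
  have lim: "(\<lambda>n. a n t) \<longlonglongrightarrow> g t * indicator {0..T} t" if t: "t \<notin> S \<union> {0, T}" for t
  proof (cases "0 < t \<and> t < T")
    case True
    then obtain e where e: "e > 0" "\<And>s. t - e < s \<Longrightarrow> s \<le> t \<Longrightarrow> 0 \<le> s \<Longrightarrow> g s = g t"
      using left[of t] t by auto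
    have "eventually (\<lambda>n. d n < e) sequentially" using d0 e(1) by (rule order_tendstoD)
    then have "eventually (\<lambda>n. a n t = g t) sequentially"
    proof eventually_elim
      case (elim n)
      then have "g (real (nat \<lfloor>t / d n\<rfloor>) * d n) = g t"
        using left_end[of t n] True by (intro e(2)) linarith+
      then show ?case using True by (simp only: a_eq less_imp_le)
    qed
    then show ?thesis using True by (simp add: tendsto_eventually)
  next
    case False
    then have "t < 0 \<or> t \<ge> T" "t \<notin> {0..T}" using t by auto
    then show ?thesis using a_out by simp
  qed
  have a_meas: "a n \<in> borel_measurable lborel" for n unfolding a_def by measurable
  have fin: "countable (S \<union> {0, T})" using S by (simp add: countable_finite)
  have meas: "(\<lambda>t. g t * indicator {0..T} t) \<in> borel_measurable lborel"
  \<comment> \<open>On \<open>S\<close> and at the end points the step functions need not converge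
    to \<open>g\<close>, so the limit is taken after setting everything to 0 there; this alters
    \<open>g\<close> on a countable set only.\<close>
  proof (rule measurable_discrete_difference[where X="S \<union> {0, T}"])
    have "S \<union> {0, T} \<in> sets lborel" using S by (simp add: sets_lborel borel_closed finite_imp_closed)
    then have [measurable]: "- (S \<union> {0, T}) \<in> sets lborel" 
      using sets.compl_sets[of "S \<union> {0, T}" lborel] by (simp add: Compl_eq_Diff_UNIV)
    show "(\<lambda>t. (if t \<in> S \<union> {0,T} then 0 else g t * indicator {0..T} t)) \<in> borel_measurable lborel"
    proof (rule borel_measurable_LIMSEQ_real)
      fix t
      show "(\<lambda>n. a n t * indicator (- (S \<union> {0, T})) t) \<longlonglongrightarrow> (if t \<in> S \<union> {0,T} then 0 else g t * indicator {0..T} t)"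
        using lim[of t] by auto
    next
      fix n
      show "(\<lambda>t. a n t * indicator (- (S \<union> {0, T})) t) \<in> borel_measurable lborel"
        using a_meas by measurable
    qed
  qed (use fin in auto)
  have "0 \<le> B" using bound[of 0] T by simp
  have w: "integrable lborel (\<lambda>t. B * indicator {0..T} t :: real)"
    using T by (intro integrable_mult_right) (simp add: integrable_indicator_iff)
  have ae: "AE t in lborel. t \<notin> S \<union> {0, T}" 
    using fin by (intro AE_not_in countable_imp_null_set_lborel)
  have lim_ae: "AE t in lborel. (\<lambda>n. a n t) \<longlonglongrightarrow> g t * indicator {0..T} t"
    using ae by eventually_elim (rule lim)
  have dom: "norm (a n t) \<le> B * indicator {0..T} t" for n t
  proof (cases "0 \<le> t \<and> t < T")
    case True
    then have "\<bar>g (real (nat \<lfloor>t / d n\<rfloor>) * d n)\<bar> \<le> B"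
      using left_end[of t n] by (intro bound) linarith+
    then show ?thesis using True by (simp only: a_eq) simp
  next
    case False
    then have "t < 0 \<or> t \<ge> T" by auto
    then show ?thesis using a_out \<open>0 \<le> B\<close> by simp
  qed
  show "integrable lborel (\<lambda>t. g t * indicator {0..T} t)"
    by (rule integrable_dominated_convergence[OF meas a_meas w lim_ae]) (use dom in auto)
  have "(\<lambda>n. integral\<^sup>L lborel (a n)) \<longlonglongrightarrow> (LINT t|lborel. g t * indicator {0..T} t)"
    by (rule integral_dominated_convergence[OF meas a_meas w lim_ae]) (use dom in auto)
  moreover have "integral\<^sup>L lborel (a n) = (\<Sum>i<Suc n. T / Suc n * g (real i * (T / Suc n)))" for n
  proof -
    have le: "real i * d n \<le> real (Suc i) * d n" for i
      using d(1)[of n] by (intro mult_right_mono) auto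
    have "integrable lborel (\<lambda>t. g (real i * d n) * indicator {real i * d n..<real (Suc i) * d n} t :: real)" for i
      using le[of i] by (intro integrable_mult_right) (simp add: integrable_indicator_iff)
    then have "integral\<^sup>L lborel (a n) =
        (\<Sum>i<Suc n. LINT t|lborel. g (real i * d n) * indicator {real i * d n..<real (Suc i) * d n} t)"
      unfolding a_def by (intro Bochner_Integration.integral_sum) auto
    also have "\<dots> = (\<Sum>i<Suc n. d n * g (real i * d n))"
      using le by (intro sum.cong refl) (simp add: algebra_simps)
    finally show ?thesis by (simp add: d_def)
  qed
  ultimately show "(\<lambda>n. \<Sum>i<Suc n. T / Suc n * g (real i * (T / Suc n))) \<longlonglongrightarrow> (LINT t|lborel. g t * indicator {0..T} t)"
    by simp
qed

subsection \<open>Moments of the number of updates\<close>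

text \<open>By \<open>k * q k = x * q (k - 1)\<close> each series is a shifted copy of the previous
  one. The factorial moment is used because \<open>k * (k - 1)\<close> vanishes for
  \<open>k \<le> 1\<close>, so that its mean is of second order in the length of a time
  step.\<close>

lemma poisson_weights_sums:
  fixes x :: real
  defines "q \<equiv> \<lambda>k. x ^ k / fact k * exp (- x)"
  shows "(\<lambda>k. real k * q k) sums x"
    and "(\<lambda>k. real (k * (k - 1)) * q k) sums x\<^sup>2"
proof -
  have q: "q sums 1"
  proof -
    have "(\<lambda>k. x ^ k / fact k) sums exp x"
      using exp_converges[of x] by (simp add: scaleR_conv_of_real field_simps)
    then have "q sums (exp x * exp (- x))" unfolding q_def by (rule sums_mult2)
    then show ?thesis by (simp add: exp_minus)
  qed
  have step: "real (Suc k) * q (Suc k) = x * q k" for k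
    by (simp add: q_def field_simps del: of_nat_Suc)
  have "(\<lambda>k. real (Suc k) * q (Suc k)) sums x" unfolding step using sums_mult[OF q, of x] by simp
  then show 1: "(\<lambda>k. real k * q k) sums x" using sums_Suc_iff[of "\<lambda>k. real k * q k" x] by simp
  have step2: "real (Suc k * (Suc k - 1)) * q (Suc k) = x * (real k * q k)" for k
    
  proof -
    have "real (Suc k * (Suc k - 1)) = real k * real (Suc k)"
      by (simp only: of_nat_mult diff_Suc_1 mult.commute)
    then show ?thesis by (simp only: mult.assoc step mult.left_commute)
  qed
  have "(\<lambda>k. real (Suc k * (Suc k - 1)) * q (Suc k)) sums x\<^sup>2"
    unfolding step2 power2_eq_square using 1 by (rule sums_mult)
  then show "(\<lambda>k. real (k * (k - 1)) * q k) sums x\<^sup>2"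
    using sums_Suc_iff[of "\<lambda>k. real (k * (k - 1)) * q k" "x\<^sup>2"] by simp
qed

text \<open>Nonnegativity lets the integral be split over the values of \<open>D\<close> in
  \<open>ennreal\<close>, so integrability is obtained together with the value.\<close>

lemma (in prob_space) expectation_discrete:
  fixes D :: "'a \<Rightarrow> nat" and f :: "nat \<Rightarrow> real"
  assumes [measurable]: "D \<in> measurable M (count_space UNIV)"
    and f: "\<And>k. f k \<ge> 0" and sums: "(\<lambda>k. f k * prob {\<omega> \<in> space M. D \<omega> = k}) sums S"
  shows "integrable M (\<lambda>\<omega>. f (D \<omega>))" "expectation (\<lambda>\<omega>. f (D \<omega>)) = S"
proof -
  have S: "S \<ge> 0" using sums f by (intro sums_le[OF _ sums_zero sums]) auto
  have "(\<integral>\<^sup>+ \<omega>. ennreal (f (D \<omega>)) \<partial>M)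
      = (\<integral>\<^sup>+ \<omega>. (\<Sum>k. ennreal (f k) * indicator {\<omega> \<in> space M. D \<omega> = k} \<omega>) \<partial>M)"
  proof (rule nn_integral_cong)
    fix \<omega> assume "\<omega> \<in> space M"
    then have "(\<lambda>k. ennreal (f k) * indicator {\<omega> \<in> space M. D \<omega> = k} \<omega>)
        = (\<lambda>k. if k = D \<omega> then ennreal (f k) else 0)" by (auto simp: fun_eq_iff indicator_def)
    then show "ennreal (f (D \<omega>)) = (\<Sum>k. ennreal (f k) * indicator {\<omega> \<in> space M. D \<omega> = k} \<omega>)"
      using sums_single[of "D \<omega>" "\<lambda>k. ennreal (f k)"] by (simp add: sums_iff)
  qed
  also have "\<dots> = (\<Sum>k. \<integral>\<^sup>+ \<omega>. ennreal (f k) * indicator {\<omega> \<in> space M. D \<omega> = k} \<omega> \<partial>M)"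
    by (rule nn_integral_suminf) measurable
  also have "\<dots> = (\<Sum>k. ennreal (f k * prob {\<omega> \<in> space M. D \<omega> = k}))"
  proof (rule suminf_cong)
    fix k
    show "(\<integral>\<^sup>+ \<omega>. ennreal (f k) * indicator {\<omega> \<in> space M. D \<omega> = k} \<omega> \<partial>M)
        = ennreal (f k * prob {\<omega> \<in> space M. D \<omega> = k})"
      by (subst nn_integral_cmult_indicator) (auto simp: emeasure_eq_measure ennreal_mult f)
  qed
  also have "\<dots> = ennreal S"
    using sums f by (subst suminf_ennreal_eq[OF _ sums]) auto
  finally have *: "(\<integral>\<^sup>+ \<omega>. ennreal (f (D \<omega>)) \<partial>M) = ennreal S" .
  then show "integrable M (\<lambda>\<omega>. f (D \<omega>))" using f by (intro integrableI_nonneg) auto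
  show "expectation (\<lambda>\<omega>. f (D \<omega>)) = S" using * f S by (intro integral_eq_nn_integral[THEN trans]) auto
qed

subsection \<open>A Poisson process of updates\<close>

locale poisson_item = prob_space M for M :: "'w measure" +
  fixes F :: "real \<Rightarrow> 'w measure" and l :: real and b :: "real \<Rightarrow> 'w \<Rightarrow> nat"
  assumes filt: "filtration (space M) F" and sub: "\<And>t. sets (F t) \<subseteq> sets M"
    and rate: "l \<ge> 0" and poisson: "poisson_updates M F l b"
begin

lemma space_F: "space (F t) = space M"
  using filt by (simp add: filtration.space_F)

lemma measurable_F_M: "f \<in> measurable (F s) N \<Longrightarrow> f \<in> measurable M N"
  using sub[of s] by (auto simp: measurable_def space_F)

lemma finite_updates: "\<omega> \<in> space M \<Longrightarrow> finite {r \<in> {0<..t}. b r \<omega> = 1}"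
  using poisson by (simp add: poisson_updates_def)

lemma update_count_measurable_F:
  "0 \<le> s \<Longrightarrow> s \<le> t \<Longrightarrow> update_count b s t \<in> measurable (F t) (count_space UNIV)"
  using poisson by (simp add: poisson_updates_def)

lemma update_count_measurable [measurable]:
  "0 \<le> s \<Longrightarrow> s \<le> t \<Longrightarrow> update_count b s t \<in> measurable M (count_space UNIV)"
  using update_count_measurable_F measurable_F_M by blast

lemma update_count_prob:
  "0 \<le> s \<Longrightarrow> s \<le> t \<Longrightarrow> prob {\<omega> \<in> space M. update_count b s t \<omega> = k}
     = (l * (t - s)) ^ k / fact k * exp (- (l * (t - s)))"
  using poisson by (simp add: poisson_updates_def)

lemma update_count_moments:
  assumes "0 \<le> s" "s \<le> t"
  shows "integrable M (\<lambda>\<omega>. real (update_count b s t \<omega>))"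
    and "expectation (\<lambda>\<omega>. real (update_count b s t \<omega>)) = l * (t - s)"
    and "integrable M (\<lambda>\<omega>. real (update_count b s t \<omega> * (update_count b s t \<omega> - 1)))"
    and "expectation (\<lambda>\<omega>. real (update_count b s t \<omega> * (update_count b s t \<omega> - 1))) = (l * (t - s))\<^sup>2"
  using expectation_discrete[OF update_count_measurable[OF assms], of real "l * (t - s)"]
    expectation_discrete[OF update_count_measurable[OF assms], of "\<lambda>k. real (k * (k - 1))" "(l * (t - s))\<^sup>2"]
  unfolding update_count_prob[OF assms]
  using poisson_weights_sums[of "l * (t - s)"] by (simp_all only: of_nat_0_le_iff)

text \<open>\<open>Y\<close> is known at time \<open>s\<close>, so its preimages lie in
  \<open>F s\<close> and are independent of the updates after \<open>s\<close>. The families of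
  preimages are closed under intersection, hence independence extends to the generated
  sigma-algebras and the mean of the product factors.\<close>

lemma update_count_indep:
  fixes Y :: "'w \<Rightarrow> nat" and G :: "nat \<Rightarrow> real"
  assumes st: "0 \<le> s" "s \<le> t" and Y: "Y \<in> measurable (F s) (count_space UNIV)"
    and G: "\<And>k. \<bar>G k\<bar> \<le> B"
  shows "integrable M (\<lambda>\<omega>. G (Y \<omega>))"
    and "integrable M (\<lambda>\<omega>. G (Y \<omega>) * real (update_count b s t \<omega>))"
    and "expectation (\<lambda>\<omega>. G (Y \<omega>) * real (update_count b s t \<omega>)) = l * (t - s) * expectation (\<lambda>\<omega>. G (Y \<omega>))"
proof -
  define D where "D = update_count b s t"
  have [measurable]: "Y \<in> measurable M (count_space UNIV)" "D \<in> measurable M (count_space UNIV)"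
    using st Y measurable_F_M by (auto simp: D_def)
  define \<Y> where "\<Y> = {Y -` A \<inter> space M | A. True}"
  define \<D> where "\<D> = {D -` A \<inter> space M | A. True}"
  have ind: "indep_set (sets (F s)) \<D>"
    using poisson st by (auto simp: poisson_updates_def \<D>_def D_def)
  have "\<Y> \<subseteq> sets (F s)" using measurable_sets[OF Y] by (auto simp: \<Y>_def space_F)
  have "\<D> \<subseteq> events" using measurable_sets[OF \<open>D \<in> _\<close>] by (auto simp: \<D>_def)
  have "indep_set \<Y> \<D>"
    using \<open>\<Y> \<subseteq> _\<close> \<open>\<D> \<subseteq> _\<close> sub[of s] indep_setD[OF ind] by (intro indep_setI) auto
  moreover have "Int_stable {f -` A \<inter> space M | A. True}" for f :: "'w \<Rightarrow> nat"
  proof (rule Int_stableI)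
    fix x y assume "x \<in> {f -` A \<inter> space M | A. True}" "y \<in> {f -` A \<inter> space M | A. True}"
    then obtain A B where "x = f -` A \<inter> space M" "y = f -` B \<inter> space M" by auto
    then have "x \<inter> y = f -` (A \<inter> B) \<inter> space M" by auto
    then show "x \<inter> y \<in> {f -` A \<inter> space M | A. True}" by blast
  qed
  then have "Int_stable \<Y>" "Int_stable \<D>" unfolding \<Y>_def \<D>_def by auto
  ultimately have "indep_set (sigma_sets (space M) \<Y>) (sigma_sets (space M) \<D>)"
    by (rule indep_set_sigma_sets)
  then have "indep_var (count_space UNIV) Y (count_space UNIV) D"
    unfolding indep_var_eq \<Y>_def \<D>_def by simp
  then have "indep_var borel (G \<circ> Y) borel (real \<circ> D)"
    by (rule indep_var_compose) auto
  then have iv: "indep_var borel (\<lambda>\<omega>. G (Y \<omega>)) borel (\<lambda>\<omega>. real (D \<omega>))" by (simp add: comp_def)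
  show 1: "integrable M (\<lambda>\<omega>. G (Y \<omega>))"
    using G by (intro integrable_const_bound[of _ B]) auto
  show "integrable M (\<lambda>\<omega>. G (Y \<omega>) * real (update_count b s t \<omega>))"
    using indep_var_integrable[OF iv 1] update_count_moments[OF st] by (simp add: D_def)
  show "expectation (\<lambda>\<omega>. G (Y \<omega>) * real (update_count b s t \<omega>)) = l * (t - s) * expectation (\<lambda>\<omega>. G (Y \<omega>))"
    using indep_var_lebesgue_integral[OF iv 1] update_count_moments[OF st] by (simp add: D_def)
qed

text \<open>The exceptional times may depend on the outcome and on the horizon. Constancy to the
  left is the form that \<open>left_Riemann_sums\<close> takes as its assumption.\<close>

definition piecewise_constant :: "(real \<Rightarrow> 'w \<Rightarrow> nat) \<Rightarrow> bool" where
  "piecewise_constant X \<longleftrightarrow> (\<forall>\<omega>\<in>space M. \<forall>T. \<exists>S. finite S \<and> (\<forall>t. 0 < t \<and> t \<le> T \<and> t \<notin> S \<longrightarrow>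
     (\<exists>e>0. \<forall>s. t - e < s \<and> s \<le> t \<and> 0 \<le> s \<longrightarrow> X s \<omega> = X t \<omega>)))"

lemma path_Riemann_sums:
  fixes f :: "nat \<Rightarrow> real"
  assumes "T > 0" "piecewise_constant X" "\<omega> \<in> space M"
    and "\<And>t. 0 \<le> t \<Longrightarrow> t \<le> T \<Longrightarrow> \<bar>f (X t \<omega>)\<bar> \<le> B"
  shows "integrable lborel (\<lambda>t. f (X t \<omega>) * indicator {0..T} t)"
    and "(\<lambda>n. \<Sum>i<Suc n. T / Suc n * f (X (real i * (T / Suc n)) \<omega>))
      \<longlonglongrightarrow> (LINT t|lborel. f (X t \<omega>) * indicator {0..T} t)"
proof -
  obtain S where S: "finite S" "\<And>t. 0 < t \<Longrightarrow> t \<le> T \<Longrightarrow> t \<notin> S \<Longrightarrow>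
     \<exists>e>0. \<forall>s. t - e < s \<and> s \<le> t \<and> 0 \<le> s \<longrightarrow> X s \<omega> = X t \<omega>"
    using assms(2,3) unfolding piecewise_constant_def by metis
  have S': "\<exists>e>0. \<forall>s. t - e < s \<and> s \<le> t \<and> 0 \<le> s \<longrightarrow> f (X s \<omega>) = f (X t \<omega>)"
    if "0 < t" "t \<le> T" "t \<notin> S" for t using S(2)[OF that] by metis
  show "integrable lborel (\<lambda>t. f (X t \<omega>) * indicator {0..T} t)"
    by (rule left_Riemann_sums(1)[of T S "\<lambda>t. f (X t \<omega>)", OF assms(1) S(1) assms(4) S'])
  show "(\<lambda>n. \<Sum>i<Suc n. T / Suc n * f (X (real i * (T / Suc n)) \<omega>))
      \<longlonglongrightarrow> (LINT t|lborel. f (X t \<omega>) * indicator {0..T} t)"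
    by (rule left_Riemann_sums(2)[of T S "\<lambda>t. f (X t \<omega>)", OF assms(1) S(1) assms(4) S'])
qed

text \<open>The path integral is a pointwise limit of grid sums, each of which involves finitely
  many times, so measurability at fixed times is enough. The bound may vary with the
  outcome.\<close>

lemma path_integral_measurable:
  fixes f :: "nat \<Rightarrow> real"
  assumes T: "T > 0" and pc: "piecewise_constant X"
    and X: "\<And>t. t \<ge> 0 \<Longrightarrow> X t \<in> measurable M (count_space UNIV)"
    and B: "\<And>\<omega>. \<omega> \<in> space M \<Longrightarrow> \<exists>B. \<forall>t. 0 \<le> t \<and> t \<le> T \<longrightarrow> \<bar>f (X t \<omega>)\<bar> \<le> B"
  shows "(\<lambda>\<omega>. LINT t|lborel. f (X t \<omega>) * indicator {0..T} t) \<in> borel_measurable M"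
proof (rule borel_measurable_LIMSEQ_real)
  fix \<omega> assume "\<omega> \<in> space M"
  moreover obtain C where "\<And>t. 0 \<le> t \<Longrightarrow> t \<le> T \<Longrightarrow> \<bar>f (X t \<omega>)\<bar> \<le> C"
    using B[OF \<open>\<omega> \<in> space M\<close>] by auto
  ultimately show "(\<lambda>n. \<Sum>i<Suc n. T / Suc n * f (X (real i * (T / Suc n)) \<omega>))
      \<longlonglongrightarrow> (LINT t|lborel. f (X t \<omega>) * indicator {0..T} t)"
    by (rule path_Riemann_sums(2)[OF T pc])
next
  fix n
  show "(\<lambda>\<omega>. \<Sum>i<Suc n. T / Suc n * f (X (real i * (T / Suc n)) \<omega>)) \<in> borel_measurable M"
  proof (intro borel_measurable_sum borel_measurable_times borel_measurable_const)
    fix i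
    have "X (real i * (T / Suc n)) \<in> measurable M (count_space UNIV)" using T by (intro X) simp
    then show "(\<lambda>\<omega>. f (X (real i * (T / Suc n)) \<omega>)) \<in> borel_measurable M"
      by (rule measurable_compose) simp
  qed
qed

text \<open>One half of Dynkin's formula: over a grid of mesh \<open>T / n\<close> the errors \<open>K D (D - 1)\<close>
  have total mean of order \<open>1 / n\<close>, and the drift terms are Riemann sums.\<close>

lemma drift_inequality:
  fixes Z :: "real \<Rightarrow> 'w \<Rightarrow> real" and G :: "nat \<Rightarrow> real"
  assumes T: "T > 0" and pc: "piecewise_constant X"
    and X: "\<And>t. t \<ge> 0 \<Longrightarrow> X t \<in> measurable (F t) (count_space UNIV)"
    and Z: "\<And>t. 0 \<le> t \<Longrightarrow> t \<le> T \<Longrightarrow> integrable M (Z t)"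
    and G: "\<And>k. \<bar>G k\<bar> \<le> B"
    and incr: "\<And>s t \<omega>. \<omega> \<in> space M \<Longrightarrow> 0 \<le> s \<Longrightarrow> s \<le> t \<Longrightarrow> t \<le> T \<Longrightarrow>
      Z t \<omega> - Z s \<omega> \<ge> G (X s \<omega>) * real (update_count b s t \<omega>)
        - K * real (update_count b s t \<omega> * (update_count b s t \<omega> - 1))"
  shows "l * expectation (\<lambda>\<omega>. LINT t|lborel. G (X t \<omega>) * indicator {0..T} t)
    \<le> expectation (Z T) - expectation (Z 0)"
proof -
  define d where "d n = T / real (Suc n)" for n
  have d: "d n > 0" "real (Suc n) * d n = T" for n using T by (auto simp: d_def)
  define R where "R n \<omega> = (\<Sum>i<Suc n. d n * G (X (real i * d n) \<omega>))" for n \<omega>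
  define I where "I \<omega> = (LINT t|lborel. G (X t \<omega>) * indicator {0..T} t)" for \<omega>
  have XM: "X t \<in> measurable M (count_space UNIV)" if "t \<ge> 0" for t
    using X[OF that] by (rule measurable_F_M)
  have GX: "integrable M (\<lambda>\<omega>. G (X t \<omega>))" if "t \<ge> 0" for t
    using update_count_indep(1)[OF that order.refl X[OF that] G] .
  have R_int: "integrable M (R n)" for n
    unfolding R_def using d(1)[of n] by (intro Bochner_Integration.integrable_sum integrable_mult_right GX) simp
  have "(\<lambda>n. R n \<omega>) \<longlonglongrightarrow> I \<omega>" if "\<omega> \<in> space M" for \<omega>
    unfolding R_def I_def d_def by (rule path_Riemann_sums[OF T pc that G])
  moreover have "I \<in> borel_measurable M"
    unfolding I_def using G by (intro path_integral_measurable[OF T pc XM]) auto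
  moreover have "\<bar>R n \<omega>\<bar> \<le> T * B" for n \<omega>
  proof -
    have "\<bar>R n \<omega>\<bar> \<le> (\<Sum>i<Suc n. \<bar>d n * G (X (real i * d n) \<omega>)\<bar>)" unfolding R_def by (rule sum_abs)
    also have "\<dots> \<le> (\<Sum>i<Suc n. d n * B)"
      using d(1)[of n] G by (intro sum_mono) (simp add: abs_mult)
    also have "\<dots> = real (Suc n) * d n * B" by simp
    finally show ?thesis unfolding d(2) .
  qed
  ultimately have lim: "(\<lambda>n. expectation (R n)) \<longlonglongrightarrow> expectation I"
    by (intro integral_dominated_convergence[where w="\<lambda>_. T * B"]) (auto intro: borel_measurable_integrable[OF R_int])
  have "l * expectation (R n) - K * (l\<^sup>2 * T * d n) \<le> expectation (Z T) - expectation (Z 0)" for n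
  proof -
    define t where "t i = real i * d n" for i
    have t: "0 \<le> t i" "t i \<le> t (Suc i)" "t (Suc i) - t i = d n" for i
      using d(1)[of n] by (auto simp: t_def algebra_simps)
    have tT: "t i \<le> T" if "i \<le> Suc n" for i
      unfolding t_def d(2)[of n, symmetric] using that d(1)[of n] by (intro mult_right_mono) auto
    \<comment> \<open>The state at the left end of a cell is independent of the updates in the cell,
      so the linear term has mean \<open>l * d n\<close> times that of \<open>G\<close>, and the
      error term has mean \<open>K * (l * d n)\<^sup>2\<close>.\<close>
    have step: "l * d n * expectation (\<lambda>\<omega>. G (X (t i) \<omega>)) - K * (l * d n)\<^sup>2
        \<le> expectation (Z (t (Suc i))) - expectation (Z (t i))" if i: "i < Suc n" for i
    proof -
      let ?D = "update_count b (t i) (t (Suc i))"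
      have "expectation (\<lambda>\<omega>. G (X (t i) \<omega>) * real (?D \<omega>) - K * real (?D \<omega> * (?D \<omega> - 1)))
          \<le> expectation (\<lambda>\<omega>. Z (t (Suc i)) \<omega> - Z (t i) \<omega>)"
        using i t tT[of i] tT[of "Suc i"]
        by (intro integral_mono Bochner_Integration.integrable_diff integrable_mult_right
            update_count_indep(2)[OF _ _ X G] update_count_moments Z incr) auto
      also have "\<dots> = expectation (Z (t (Suc i))) - expectation (Z (t i))"
        using i t tT[of i] tT[of "Suc i"] by (intro Bochner_Integration.integral_diff Z) auto
      also have "expectation (\<lambda>\<omega>. G (X (t i) \<omega>) * real (?D \<omega>) - K * real (?D \<omega> * (?D \<omega> - 1)))
          = expectation (\<lambda>\<omega>. G (X (t i) \<omega>) * real (?D \<omega>)) - expectation (\<lambda>\<omega>. K * real (?D \<omega> * (?D \<omega> - 1)))"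
        using t by (intro Bochner_Integration.integral_diff integrable_mult_right
            update_count_indep(2)[OF _ _ X G] update_count_moments) auto
      also have "expectation (\<lambda>\<omega>. G (X (t i) \<omega>) * real (?D \<omega>)) = l * d n * expectation (\<lambda>\<omega>. G (X (t i) \<omega>))"
        using update_count_indep(3)[OF t(1) t(2) X[OF t(1)] G] t(3) by simp
      also have "expectation (\<lambda>\<omega>. K * real (?D \<omega> * (?D \<omega> - 1))) = K * (l * d n)\<^sup>2"
        using update_count_moments(4)[OF t(1) t(2)] unfolding t(3)
        by (simp only: integral_mult_right_zero)
      finally show ?thesis .
    qed
    have R: "expectation (R n) = (\<Sum>i<Suc n. d n * expectation (\<lambda>\<omega>. G (X (t i) \<omega>)))"
      unfolding R_def t_def[symmetric]
      by (subst Bochner_Integration.integral_sum) (use GX t in \<open>auto simp: integral_mult_right_zero\<close>)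
    have split: "l * (\<Sum>i<Suc n. d n * expectation (\<lambda>\<omega>. G (X (t i) \<omega>))) - real (Suc n) * (K * (l * d n)\<^sup>2)
        = (\<Sum>i<Suc n. l * d n * expectation (\<lambda>\<omega>. G (X (t i) \<omega>)) - K * (l * d n)\<^sup>2)"
      by (simp only: sum_subtractf sum_distrib_left sum_constant card_lessThan mult.assoc)
    \<comment> \<open>The \<open>Suc n\<close> quadratic errors add up to a multiple of the mesh
      \<open>d n\<close>, which tends to 0.\<close>
    have err: "real (Suc n) * (K * (l * d n)\<^sup>2) = K * (l\<^sup>2 * (real (Suc n) * d n) * d n)"
      by (simp only: power2_eq_square mult_ac)
    have "l * expectation (R n) - K * (l\<^sup>2 * T * d n)
        = (\<Sum>i<Suc n. l * d n * expectation (\<lambda>\<omega>. G (X (t i) \<omega>)) - K * (l * d n)\<^sup>2)"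
      unfolding R err[unfolded d(2), symmetric] by (rule split)
    also have "\<dots> \<le> (\<Sum>i<Suc n. expectation (Z (t (Suc i))) - expectation (Z (t i)))"
      by (intro sum_mono step) auto
    also have "\<dots> = expectation (Z (t (Suc n))) - expectation (Z (t 0))"
      by (rule sum_lessThan_telescope)
    finally show ?thesis unfolding t_def d(2) by simp
  qed
  moreover have "(\<lambda>n. l * expectation (R n) - K * (l\<^sup>2 * T * d n)) \<longlonglongrightarrow> l * expectation I - K * (l\<^sup>2 * T * 0)"
  proof (intro tendsto_intros lim)
    show "d \<longlonglongrightarrow> 0" unfolding d_def by real_asymp
  qed
  ultimately show ?thesis unfolding I_def[symmetric]
    by (intro LIMSEQ_le_const2[where X="\<lambda>n. l * expectation (R n) - K * (l\<^sup>2 * T * d n)"]) auto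
qed

end

subsection \<open>Costs of a single item\<close>

text \<open>Both 1 and \<open>D\<close> are at most \<open>D * (D - 1)\<close>. This absorbs every
  change of value and every fetch cost on a step with two or more updates; it is the source of the
  constant \<open>K = 3 * c\<close> below.\<close>

lemma quadratic_error:
  fixes c :: real
  assumes "c \<ge> 0" "D \<ge> 2"
  shows "c + 2 * c * real D \<le> 3 * c * real (D * (D - 1))"
proof -
  have "real D * 1 \<le> real D * real (D - 1)" using assms(2) by (intro mult_left_mono) auto
  moreover have "real D \<ge> 2" using assms(2) by simp
  ultimately have "1 + 2 * real D \<le> 3 * real (D * (D - 1))" unfolding of_nat_mult by linarith
  from mult_left_mono[OF this assms(1)] show ?thesis by (simp add: algebra_simps)
qed

lemma indicator_interval_integrable: "integrable lborel (\<lambda>t. indicator {0..T::real} t :: real)"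
  by (simp add: integrable_indicator_iff emeasure_lborel_Icc_eq)

locale push_item = poisson_item +
  fixes u \<Delta> :: "real \<Rightarrow> 'a \<Rightarrow> nat" and d0 :: nat
  assumes path: "\<And>\<omega>. \<omega> \<in> space M \<Longrightarrow> age_path b u \<Delta> d0 \<omega>"
    and \<Delta>_meas: "\<And>t. t \<ge> 0 \<Longrightarrow> \<Delta> t \<in> measurable (F t) (count_space UNIV)"
    and u_meas: "\<And>t. t \<ge> 0 \<Longrightarrow> u t \<in> measurable (F t) (count_space UNIV)"
    and card_meas: "\<And>t. t \<ge> 0 \<Longrightarrow> (\<lambda>\<omega>. card (fetch_times u t \<omega>)) \<in> measurable (F t) (count_space UNIV)"
begin

abbreviation "X \<equiv> residual_age u \<Delta>"
abbreviation "fetches t \<omega> \<equiv> real (card (fetch_times u t \<omega>))"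

definition total_age :: "real \<Rightarrow> 'a \<Rightarrow> real" where
  "total_age T \<omega> = (LINT t|lborel. real (X t \<omega>) * indicator {0..T} t)"

text \<open>Values in \<open>ennreal\<close> also cover policies whose number of fetches is not
  integrable.\<close>

definition item_cost :: "real \<Rightarrow> real \<Rightarrow> real \<Rightarrow> 'a \<Rightarrow> ennreal" where
  "item_cost h c T \<omega> = ennreal (c * fetches T \<omega>)
     + (\<integral>\<^sup>+ t. ennreal (h * real (\<Delta> t \<omega>)) * indicator {0..T} t \<partial>lborel)"

lemma X_meas: "t \<ge> 0 \<Longrightarrow> X t \<in> measurable (F t) (count_space UNIV)"
proof -
  assume t: "t \<ge> 0"
  have "(\<lambda>\<omega>. (\<lambda>(x, y). x * (1 - y)) (\<Delta> t \<omega>, u t \<omega>)) \<in> measurable (F t) (count_space UNIV)"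
    by (rule measurable_compose[OF measurable_Pair[OF \<Delta>_meas[OF t] u_meas[OF t]]])
      (simp add: pair_measure_countable)
  then show ?thesis by (simp add: residual_age_def[abs_def])
qed

lemma piecewise_constant_X: "piecewise_constant X"
  unfolding piecewise_constant_def
proof (intro ballI allI)
  fix \<omega> and T :: real assume "\<omega> \<in> space M"
  then interpret age_path b u \<Delta> d0 \<omega> by (rule path)
  define S where "S = {r \<in> {0<..T}. b r \<omega> = 1} \<union> {r \<in> {0<..T}. u r \<omega> = 1}"
  have "finite S" unfolding S_def using updates[of T] finite_fetch_interval[of 0 T] by simp
  moreover have "\<exists>e>0. \<forall>s. t - e < s \<and> s \<le> t \<and> 0 \<le> s \<longrightarrow> X s \<omega> = X t \<omega>"
    if "0 < t \<and> t \<le> T \<and> t \<notin> S" for t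
  proof -
    have t: "0 < t" "b t \<omega> \<noteq> 1" "u t \<omega> \<noteq> 1" using that by (auto simp: S_def)
    show ?thesis by (rule locally_constant[OF t]) blast
  qed
  ultimately show "\<exists>S. finite S \<and> (\<forall>t. 0 < t \<and> t \<le> T \<and> t \<notin> S \<longrightarrow>
     (\<exists>e>0. \<forall>s. t - e < s \<and> s \<le> t \<and> 0 \<le> s \<longrightarrow> X s \<omega> = X t \<omega>))" by blast
qed

lemma X_le:
  assumes "\<omega> \<in> space M" "0 \<le> t" "t \<le> T"
  shows "real (X t \<omega>) \<le> real d0 + real (update_count b 0 T \<omega>)"
proof -
  interpret age_path b u \<Delta> d0 \<omega> using assms(1) by (rule path)
  show ?thesis using residual_age_le[OF assms(2)] update_count_split[OF order.refl assms(2,3)] by linarith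
qed

lemma path_integrable:
  assumes "T > 0" "\<omega> \<in> space M"
  shows "integrable lborel (\<lambda>t. real (X t \<omega>) * indicator {0..T} t)"
  using X_le[OF assms(2)]
  by (intro path_Riemann_sums(1)[OF assms(1) piecewise_constant_X assms(2)]) (simp only: abs_of_nat)

lemma total_age_bounds:
  assumes "T > 0" "\<omega> \<in> space M"
  shows "0 \<le> total_age T \<omega>" "total_age T \<omega> \<le> T * (real d0 + real (update_count b 0 T \<omega>))"
proof -
  show "0 \<le> total_age T \<omega>" unfolding total_age_def by (intro integral_nonneg_AE) auto
  have "total_age T \<omega> \<le> (LINT t|lborel. (real d0 + real (update_count b 0 T \<omega>)) * indicator {0..T} t)"
    unfolding total_age_def using assms X_le[OF assms(2)]
    by (intro integral_mono path_integrable integrable_mult_right indicator_interval_integrable)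
      (auto split: split_indicator)
  then show "total_age T \<omega> \<le> T * (real d0 + real (update_count b 0 T \<omega>))" using assms by (simp add: mult.commute)
qed

lemma total_age_integrable:
  assumes T: "T > 0"
  shows "integrable M (total_age T)"
proof (rule Bochner_Integration.integrable_bound)
  show "integrable M (\<lambda>\<omega>. T * (real d0 + real (update_count b 0 T \<omega>)))"
    using T by (intro integrable_mult_right Bochner_Integration.integrable_add update_count_moments) auto
  show "total_age T \<in> borel_measurable M"
    unfolding total_age_def
  proof (rule path_integral_measurable[OF T piecewise_constant_X])
    fix \<omega> assume "\<omega> \<in> space M"
    then show "\<exists>B. \<forall>t. 0 \<le> t \<and> t \<le> T \<longrightarrow> \<bar>real (X t \<omega>)\<bar> \<le> B"
      using X_le[of \<omega> _ T] unfolding abs_of_nat by blast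
  qed (use X_meas measurable_F_M in blast)
  show "AE \<omega> in M. norm (total_age T \<omega>) \<le> norm (T * (real d0 + real (update_count b 0 T \<omega>)))"
    using total_age_bounds[OF T] T by (intro AE_I2) auto
qed

text \<open>\<open>\<Delta>\<close> and the residual age differ only at fetch times, which form a
  null set, so the running cost may be computed from the piecewise constant process
  \<open>X\<close>.\<close>

lemma running_cost_eq:
  assumes T: "T > 0" and \<omega>: "\<omega> \<in> space M" and h: "h \<ge> 0"
  shows "(\<integral>\<^sup>+ t. ennreal (h * real (\<Delta> t \<omega>)) * indicator {0..T} t \<partial>lborel) = ennreal (h * total_age T \<omega>)"
proof -
  interpret age_path b u \<Delta> d0 \<omega> using \<omega> by (rule path)
  have "AE t in lborel. t \<notin> fetch_times u T \<omega>"
    using finite_fetch[of T] T by (intro AE_not_in countable_imp_null_set_lborel countable_finite) simp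
  then have "AE t in lborel. ennreal (h * real (\<Delta> t \<omega>)) * indicator {0..T} t
      = ennreal (h * (real (X t \<omega>) * indicator {0..T} t))"
  proof eventually_elim
    case (elim t)
    then show ?case using fetch[of t]
      by (cases "t \<in> {0..T}") (auto simp: fetch_times_def residual_age_def)
  qed
  then have "(\<integral>\<^sup>+ t. ennreal (h * real (\<Delta> t \<omega>)) * indicator {0..T} t \<partial>lborel)
      = (\<integral>\<^sup>+ t. ennreal (h * (real (X t \<omega>) * indicator {0..T} t)) \<partial>lborel)"
    by (rule nn_integral_cong_AE)
  also have "\<dots> = ennreal (LINT t|lborel. h * (real (X t \<omega>) * indicator {0..T} t))"
    using h by (intro nn_integral_eq_integral integrable_mult_right path_integrable T \<omega>) auto
  finally show ?thesis by (simp add: total_age_def)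
qed

lemma fetches_meas [measurable]: "t \<ge> 0 \<Longrightarrow> fetches t \<in> borel_measurable M"
  using measurable_compose[OF measurable_F_M[OF card_meas], of t real borel] by simp

lemma item_cost_eq:
  "T > 0 \<Longrightarrow> \<omega> \<in> space M \<Longrightarrow> h \<ge> 0 \<Longrightarrow>
    item_cost h c T \<omega> = ennreal (c * fetches T \<omega>) + ennreal (h * total_age T \<omega>)"
  by (simp add: item_cost_def running_cost_eq)

lemma item_cost_meas: "T > 0 \<Longrightarrow> h \<ge> 0 \<Longrightarrow> item_cost h c T \<in> borel_measurable M"
proof -
  assume T: "T > 0" "h \<ge> 0"
  have [measurable]: "total_age T \<in> borel_measurable M"
    using total_age_integrable[OF T(1)] by (rule borel_measurable_integrable)
  have [measurable]: "fetches T \<in> borel_measurable M" using T by (intro fetches_meas) simp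
  show ?thesis using T by (subst measurable_cong[OF item_cost_eq[OF T(1) _ T(2)]]) auto
qed

lemma expected_item_cost:
  assumes T: "T > 0" and h: "h \<ge> 0" and c: "c \<ge> 0" and int: "integrable M (fetches T)"
  shows "(\<integral>\<^sup>+ \<omega>. item_cost h c T \<omega> \<partial>M)
    = ennreal (c * expectation (fetches T) + h * expectation (total_age T))"
proof -
  have "(\<integral>\<^sup>+ \<omega>. item_cost h c T \<omega> \<partial>M) = (\<integral>\<^sup>+ \<omega>. ennreal (c * fetches T \<omega> + h * total_age T \<omega>) \<partial>M)"
    using total_age_bounds[OF T] h c
    by (intro nn_integral_cong) (simp add: item_cost_eq[OF T _ h] ennreal_plus)
  also have "\<dots> = ennreal (expectation (\<lambda>\<omega>. c * fetches T \<omega> + h * total_age T \<omega>))"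
    using total_age_bounds[OF T] h c
    by (intro nn_integral_eq_integral Bochner_Integration.integrable_add integrable_mult_right int
        total_age_integrable T AE_I2) auto
  also have "expectation (\<lambda>\<omega>. c * fetches T \<omega> + h * total_age T \<omega>)
      = c * expectation (fetches T) + h * expectation (total_age T)"
    by (subst Bochner_Integration.integral_add)
      (auto intro: integrable_mult_right int total_age_integrable T simp: integral_mult_right_zero)
  finally show ?thesis .
qed

lemma fetches_integrable_le:
  assumes "integrable M (fetches T)" "0 \<le> t" "t \<le> T"
  shows "integrable M (fetches t)"
proof (rule Bochner_Integration.integrable_bound[OF assms(1)])
  show "AE \<omega> in M. norm (fetches t \<omega>) \<le> norm (fetches T \<omega>)"
  proof (rule AE_I2)
    fix \<omega> assume "\<omega> \<in> space M"
    then interpret age_path b u \<Delta> d0 \<omega> by (rule path)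
    show "norm (fetches t \<omega>) \<le> norm (fetches T \<omega>)" using card_fetch_times[OF assms(2,3)] by simp
  qed
qed (use assms in auto)

lemma value_integrable:
  fixes V :: "nat \<Rightarrow> real"
  assumes "\<And>k. 0 \<le> V k" "\<And>k. V k \<le> c" "t \<ge> 0"
  shows "integrable M (\<lambda>\<omega>. V (X t \<omega>))"
    and "0 \<le> expectation (\<lambda>\<omega>. V (X t \<omega>))" "expectation (\<lambda>\<omega>. V (X t \<omega>)) \<le> c"
proof -
  have "(\<lambda>\<omega>. V (X t \<omega>)) \<in> borel_measurable M"
    using measurable_compose[OF measurable_F_M[OF X_meas[OF assms(3)]], of V borel] by simp
  then show 1: "integrable M (\<lambda>\<omega>. V (X t \<omega>))"
    using assms by (intro integrable_const_bound[of _ c]) auto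
  show "0 \<le> expectation (\<lambda>\<omega>. V (X t \<omega>))" using assms by (intro integral_nonneg_AE) auto
  have "expectation (\<lambda>\<omega>. V (X t \<omega>)) \<le> expectation (\<lambda>\<omega>. c)"
    using assms 1 by (intro integral_mono) auto
  then show "expectation (\<lambda>\<omega>. V (X t \<omega>)) \<le> c" by (simp add: prob_space)
qed

text \<open>A fetch at time 0 belongs to \<open>fetch_times\<close> but to no interval
  \<open>(s, t]\<close>. It accounts for one \<open>c\<close> in the slack of the upper
  bound.\<close>

lemma fetch_0_le: "\<omega> \<in> space M \<Longrightarrow> fetches 0 \<omega> \<le> 1"
proof -
  have "fetch_times u 0 \<omega> \<subseteq> {0}" by (auto simp: fetch_times_def)
  then have "card (fetch_times u 0 \<omega>) \<le> card {0::real}" by (intro card_mono) auto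
  then show ?thesis by simp
qed

text \<open>The drift inequality is applied to \<open>Z\<close>, the value of the residual age plus
  the fetch costs so far. The slack \<open>c\<close> bounds the final value \<open>V (X T)\<close>,
  while \<open>Z 0 \<ge> 0\<close> is dropped. If the number of fetches is not integrable, the
  expected cost is infinite.\<close>

lemma item_cost_lower_bound:
  assumes m: "is_eta_star l h c m" and h: "h > 0" and c: "c > 0" and T: "T > 0"
  shows "ennreal (c_B l h c m * T) \<le> (\<integral>\<^sup>+ \<omega>. item_cost h c T \<omega> \<partial>M) + ennreal c"
proof (cases "integrable M (fetches T)")
  case False
  have "(\<integral>\<^sup>+ \<omega>. ennreal (c * fetches T \<omega>) \<partial>M) = \<infinity>"
  proof (rule ccontr)
    assume "(\<integral>\<^sup>+ \<omega>. ennreal (c * fetches T \<omega>) \<partial>M) \<noteq> \<infinity>"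
    then have "integrable M (\<lambda>\<omega>. c * fetches T \<omega>)"
      using c T by (intro integrableI_nonneg) (auto simp: top.not_eq_extremum)
    then show False using False c by simp
  qed
  moreover have "(\<integral>\<^sup>+ \<omega>. ennreal (c * fetches T \<omega>) \<partial>M) \<le> (\<integral>\<^sup>+ \<omega>. item_cost h c T \<omega> \<partial>M)"
    unfolding item_cost_def by (intro nn_integral_mono) simp
  ultimately show ?thesis by (simp add: top_unique)
next
  case int: True
  define V where "V = rel_value l h c m"
  define G where "G k = V (Suc k) - V k" for k
  define C where "C = c_B l h c m"
  define Z where "Z t \<omega> = V (X t \<omega>) + c * fetches t \<omega>" for t \<omega>
  have V: "0 \<le> V k" "V k \<le> c" for k
    using rel_value_bounds[OF m rate h c] by (auto simp: V_def)
  have G: "\<bar>G k\<bar> \<le> c" for k using V[of k] V[of "Suc k"] by (simp add: G_def)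
  \<comment> \<open>Below \<open>m\<close> this is an equality; from \<open>m\<close> on the right
    side is 0 and \<open>c_B_le\<close> makes the left side nonpositive.\<close>
  have drift: "C - h * real k \<le> l * G k" for k
    using rel_value_drift[OF m, of k] c_B_le[OF m rate h c, of k] by (auto simp: G_def V_def C_def split: if_splits)
  have Z_int: "integrable M (Z t)" if "0 \<le> t" "t \<le> T" for t
    unfolding Z_def using that V
    by (intro Bochner_Integration.integrable_add integrable_mult_right value_integrable(1) fetches_integrable_le[OF int]) auto
  have "l * expectation (\<lambda>\<omega>. LINT t|lborel. G (X t \<omega>) * indicator {0..T} t) \<le> expectation (Z T) - expectation (Z 0)"
  proof (rule drift_inequality[OF T piecewise_constant_X X_meas Z_int G, where K="3 * c"])
    fix s t :: real and \<omega> assume \<omega>: "\<omega> \<in> space M" and st: "0 \<le> s" "s \<le> t"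
    interpret age_path b u \<Delta> d0 \<omega> using \<omega> by (rule path)
    define D where "D = update_count b s t \<omega>"
    have "V (X s \<omega> + D) - V (X s \<omega>) \<le> Z t \<omega> - Z s \<omega>"
      using value_increase[OF st V] card_fetch_times[OF st] by (simp add: Z_def D_def algebra_simps)
    \<comment> \<open>With at most one update the linear term is exact; otherwise
      \<open>quadratic_error\<close> covers the crude bounds on \<open>V\<close> and
      \<open>G\<close>.\<close>
    moreover have "G (X s \<omega>) * real D - 3 * c * real (D * (D - 1)) \<le> V (X s \<omega> + D) - V (X s \<omega>)"
    proof (cases "D \<ge> 2")
      case True
      have "G (X s \<omega>) * real D \<le> c * real D" using G[of "X s \<omega>"] by (intro mult_right_mono) auto
      moreover have "0 \<le> c * real D" using c by simp
      ultimately show ?thesis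
        using quadratic_error[of c D] True c V[of "X s \<omega> + D"] V[of "X s \<omega>"] by linarith
    next
      case False
      then have "D = 0 \<or> D = 1" by auto
      then show ?thesis by (auto simp: G_def)
    qed
    ultimately show "G (X s \<omega>) * real (update_count b s t \<omega>)
        - 3 * c * real (update_count b s t \<omega> * (update_count b s t \<omega> - 1)) \<le> Z t \<omega> - Z s \<omega>"
      unfolding D_def by linarith
  qed
  \<comment> \<open>The inequality \<open>drift\<close> is integrated along each path and then over
    the outcomes; the second integration requires the path integral \<open>I\<close> to be
    integrable.\<close>
  moreover have "C * T - h * expectation (total_age T)
      \<le> l * expectation (\<lambda>\<omega>. LINT t|lborel. G (X t \<omega>) * indicator {0..T} t)"
  proof -
    define I where "I \<omega> = (LINT t|lborel. G (X t \<omega>) * indicator {0..T} t)" for \<omega>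
    have Gi: "integrable lborel (\<lambda>t. G (X t \<omega>) * indicator {0..T} t)" if "\<omega> \<in> space M" for \<omega>
      using G by (intro path_Riemann_sums(1)[OF T piecewise_constant_X that]) auto
    have ineq: "C * T - h * total_age T \<omega> \<le> l * I \<omega>" if \<omega>: "\<omega> \<in> space M" for \<omega>
    proof -
      have "C * T - h * total_age T \<omega>
          = (LINT t|lborel. C * indicator {0..T} t - h * (real (X t \<omega>) * indicator {0..T} t))"
        unfolding total_age_def using T path_integrable[OF T \<omega>]
        by (subst Bochner_Integration.integral_diff) (auto intro!: integrable_mult_right indicator_interval_integrable)
      also have "\<dots> \<le> (LINT t|lborel. l * (G (X t \<omega>) * indicator {0..T} t))"
        using T path_integrable[OF T \<omega>] Gi[OF \<omega>] drift
        by (intro integral_mono Bochner_Integration.integrable_diff integrable_mult_right indicator_interval_integrable)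
          (auto split: split_indicator)
      finally show ?thesis by (simp add: I_def)
    qed
    have "I \<in> borel_measurable M"
      unfolding I_def using G measurable_F_M[OF X_meas]
      by (intro path_integral_measurable[OF T piecewise_constant_X]) auto
    moreover have "\<bar>I \<omega>\<bar> \<le> c * T" if \<omega>: "\<omega> \<in> space M" for \<omega>
    proof -
      have "\<bar>I \<omega>\<bar> \<le> (LINT t|lborel. \<bar>G (X t \<omega>) * indicator {0..T} t\<bar>)"
        unfolding I_def by (rule integral_abs_bound)
      also have "\<dots> \<le> (LINT t|lborel. c * indicator {0..T} t)"
        using T Gi[OF \<omega>] G by (intro integral_mono integrable_abs integrable_mult_right indicator_interval_integrable)
          (auto split: split_indicator)
      finally show ?thesis using T by simp
    qed
    ultimately have I_int: "integrable M I"
      by (intro integrable_const_bound[of _ "c * T"]) auto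
    have "C * T - h * expectation (total_age T) = expectation (\<lambda>\<omega>. C * T - h * total_age T \<omega>)"
      using total_age_integrable[OF T] by (subst Bochner_Integration.integral_diff) (auto simp: prob_space)
    also have "\<dots> \<le> expectation (\<lambda>\<omega>. l * I \<omega>)"
      using total_age_integrable[OF T] I_int ineq by (intro integral_mono) auto
    finally show ?thesis by (simp add: I_def)
  qed
  moreover have "expectation (Z T) \<le> c + c * expectation (fetches T)"
    unfolding Z_def using T int value_integrable[OF V, of T]
    by (subst Bochner_Integration.integral_add) auto
  moreover have "0 \<le> expectation (Z 0)" unfolding Z_def using V c by (intro integral_nonneg_AE) auto
  ultimately have "C * T \<le> (c * expectation (fetches T) + h * expectation (total_age T)) + c" by linarith
  then have "ennreal (C * T) \<le> ennreal (c * expectation (fetches T) + h * expectation (total_age T) + c)"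
    by (rule ennreal_leI)
  also have "\<dots> = ennreal (c * expectation (fetches T) + h * expectation (total_age T)) + ennreal c"
  proof (rule ennreal_plus)
    have "0 \<le> expectation (fetches T)" "0 \<le> expectation (total_age T)"
      using total_age_bounds(1)[OF T] by (auto intro!: integral_nonneg_AE)
    then show "0 \<le> c * expectation (fetches T) + h * expectation (total_age T)" using h c by simp
  qed (use c in simp)
  also have "ennreal (c * expectation (fetches T) + h * expectation (total_age T)) = (\<integral>\<^sup>+ \<omega>. item_cost h c T \<omega> \<partial>M)"
    using h c by (intro expected_item_cost[symmetric] T int) auto
  finally show ?thesis by (simp add: C_def)
qed

text \<open>Under the threshold policy the residual age stays below \<open>m\<close>, where the
  drift relation is an equality, and steps with at most one update are exact. The slack
  \<open>2 * c\<close> bounds \<open>Z 0\<close>: an initial value of at most \<open>c\<close> and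
  possibly a fetch at time 0.\<close>

lemma threshold_cost_upper_bound:
  assumes m: "is_eta_star l h c m" and h: "h > 0" and c: "c > 0" and T: "T > 0"
    and thr: "\<And>t \<omega>. t \<ge> 0 \<Longrightarrow> \<omega> \<in> space M \<Longrightarrow> u t \<omega> = (if \<Delta> t \<omega> \<ge> m then 1 else 0)"
  shows "(\<integral>\<^sup>+ \<omega>. item_cost h c T \<omega> \<partial>M) \<le> ennreal (c_B l h c m * T + 2 * c)"
proof -
  have tpath: "threshold_path b u \<Delta> d0 \<omega> m" if "\<omega> \<in> space M" for \<omega>
    using path[OF that] thr[OF _ that] is_eta_star_pos[OF m]
    by (simp add: threshold_path_def threshold_path_axioms_def)
  define V where "V = rel_value l h c m"
  define G where "G k = V (Suc k) - V k" for k
  define C where "C = c_B l h c m"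
  define Z where "Z t \<omega> = V (X t \<omega>) + c * fetches t \<omega>" for t \<omega>
  have V: "0 \<le> V k" "V k \<le> c" for k
    using rel_value_bounds[OF m rate h c] by (auto simp: V_def)
  have V0m: "V 0 = 0" "V m = c" using is_eta_star_pos[OF m] by (auto simp: V_def rel_value_simps)
  have G: "\<bar>G k\<bar> \<le> c" for k using V[of k] V[of "Suc k"] by (simp add: G_def)
  have drift: "l * G k = C - h * real k" if "k < m" for k
    using rel_value_drift[OF m, of k] that by (simp add: G_def V_def C_def)
  have int: "integrable M (fetches T)"
  proof (rule Bochner_Integration.integrable_bound)
    show "integrable M (\<lambda>\<omega>. 1 + real (update_count b 0 T \<omega>))"
      using T by (intro Bochner_Integration.integrable_add update_count_moments) auto
    show "AE \<omega> in M. norm (fetches T \<omega>) \<le> norm (1 + real (update_count b 0 T \<omega>))"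
    proof (rule AE_I2)
      fix \<omega> assume \<omega>: "\<omega> \<in> space M"
      then interpret threshold_path b u \<Delta> d0 \<omega> m by (rule tpath)
      show "norm (fetches T \<omega>) \<le> norm (1 + real (update_count b 0 T \<omega>))"
        using card_fetch_times[of 0 T] fetches_le_updates[of 0 T] T fetch_0_le[OF \<omega>] by simp
    qed
  qed (use T in simp)
  have Z_int: "integrable M (\<lambda>\<omega>. - Z t \<omega>)" if "0 \<le> t" "t \<le> T" for t
    unfolding Z_def using that V
    by (intro Bochner_Integration.integrable_minus Bochner_Integration.integrable_add integrable_mult_right value_integrable(1) fetches_integrable_le[OF int]) auto
  \<comment> \<open>\<open>drift_inequality\<close> turns lower bounds on increments into a lower
    bound on the mean, so the reverse estimate is obtained from \<open>- Z\<close> and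
    \<open>- G\<close>.\<close>
  have "l * expectation (\<lambda>\<omega>. LINT t|lborel. - G (X t \<omega>) * indicator {0..T} t)
      \<le> expectation (\<lambda>\<omega>. - Z T \<omega>) - expectation (\<lambda>\<omega>. - Z 0 \<omega>)"
  proof (rule drift_inequality[OF T piecewise_constant_X X_meas Z_int, where K="3 * c" and B=c])
    fix s t :: real and \<omega> assume \<omega>: "\<omega> \<in> space M" and st: "0 \<le> s" "s \<le> t"
    interpret threshold_path b u \<Delta> d0 \<omega> m using \<omega> by (rule tpath)
    define D where "D = update_count b s t \<omega>"
    define J where "J = card {r \<in> {s<..t}. u r \<omega> = 1}"
    have J: "J \<le> D" using fetches_le_updates[OF st] by (simp add: J_def D_def)
    have Z: "Z t \<omega> - Z s \<omega> = V (X t \<omega>) - V (X s \<omega>) + c * real J"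
      using card_fetch_times[OF st] by (simp add: Z_def J_def algebra_simps)
    have "Z t \<omega> - Z s \<omega> \<le> G (X s \<omega>) * real D + 3 * c * real (D * (D - 1))"
    proof (cases "D \<ge> 2")
      case True
      have "- c * real D \<le> G (X s \<omega>) * real D" using G[of "X s \<omega>"] by (intro mult_right_mono) auto
      moreover have "c * real J \<le> c * real D" using J c by (intro mult_left_mono) auto
      ultimately show ?thesis unfolding Z
        using quadratic_error[of c D] True c V[of "X t \<omega>"] V[of "X s \<omega>"] by linarith
    next
      case False
      then have "V (X t \<omega>) + c * real J = V (X s \<omega> + D)"
        using value_increase_eq[OF st V0m] by (simp add: J_def D_def)
      moreover have "D = 0 \<or> D = 1" using False by auto
      ultimately show ?thesis unfolding Z by (auto simp: G_def)
    qed
    then show "- G (X s \<omega>) * real (update_count b s t \<omega>)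
        - 3 * c * real (update_count b s t \<omega> * (update_count b s t \<omega> - 1)) \<le> - Z t \<omega> - - Z s \<omega>"
      unfolding D_def by simp
  qed (use G in auto)
  moreover have "l * expectation (\<lambda>\<omega>. LINT t|lborel. - G (X t \<omega>) * indicator {0..T} t)
      = h * expectation (total_age T) - C * T"
  proof -
    have "l * (LINT t|lborel. - G (X t \<omega>) * indicator {0..T} t) = h * total_age T \<omega> - C * T"
      if \<omega>: "\<omega> \<in> space M" for \<omega>
    proof -
      interpret threshold_path b u \<Delta> d0 \<omega> m using \<omega> by (rule tpath)
      have "l * (LINT t|lborel. - G (X t \<omega>) * indicator {0..T} t)
          = (LINT t|lborel. h * (real (X t \<omega>) * indicator {0..T} t) - C * indicator {0..T} t)"
        unfolding integral_mult_right_zero[symmetric]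
      proof (rule Bochner_Integration.integral_cong[OF refl])
        fix t :: real
        show "l * (- G (X t \<omega>) * indicator {0..T} t)
            = h * (real (X t \<omega>) * indicator {0..T} t) - C * indicator {0..T} t"
          using drift[OF residual_age_less[of t]] by (cases "t \<in> {0..T}") auto
      qed
      also have "\<dots> = h * total_age T \<omega> - C * T"
        unfolding total_age_def using T path_integrable[OF T \<omega>]
        by (subst Bochner_Integration.integral_diff) (auto intro!: integrable_mult_right indicator_interval_integrable)
      finally show ?thesis .
    qed
    then have "l * expectation (\<lambda>\<omega>. LINT t|lborel. - G (X t \<omega>) * indicator {0..T} t)
        = expectation (\<lambda>\<omega>. h * total_age T \<omega> - C * T)"
      unfolding integral_mult_right_zero[symmetric] by (intro Bochner_Integration.integral_cong) auto
    also have "\<dots> = h * expectation (total_age T) - C * T"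
      using total_age_integrable[OF T] by (subst Bochner_Integration.integral_diff) (auto simp: prob_space)
    finally show ?thesis .
  qed
  moreover have "c * expectation (fetches T) \<le> expectation (Z T)"
    unfolding Z_def using T int value_integrable[OF V, of T]
    by (subst Bochner_Integration.integral_add) auto
  moreover have "expectation (Z 0) \<le> 2 * c"
  proof -
    have "expectation (Z 0) \<le> expectation (\<lambda>_. 2 * c)"
    proof (rule integral_mono)
      show "integrable M (Z 0)" using Z_int[of 0] T by simp
      fix \<omega> assume "\<omega> \<in> space M"
      then have "c * fetches 0 \<omega> \<le> c * 1" using c by (intro mult_left_mono fetch_0_le) auto
      then show "Z 0 \<omega> \<le> 2 * c" using V(2)[of "X 0 \<omega>"] by (simp add: Z_def)
    qed simp
    then show ?thesis by (simp add: prob_space)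
  qed
  ultimately have "c * expectation (fetches T) + h * expectation (total_age T) \<le> C * T + 2 * c" by simp
  then show ?thesis
    using expected_item_cost[OF T _ _ int, of h c] h c by (simp add: C_def ennreal_leI)
qed

end

subsection \<open>Existence of the threshold policy\<close>

lemma update_count_less:
  assumes "finite {r \<in> {0<..t}. b r \<omega> = 1}" "0 \<le> s" "s < t" "b t \<omega> = 1"
  shows "update_count b 0 s \<omega> < update_count b 0 t \<omega>"
proof -
  have "t \<in> {r \<in> {s<..t}. b r \<omega> = 1}" using assms by auto
  moreover have "finite {r \<in> {s<..t}. b r \<omega> = 1}"
    using assms by (auto intro: finite_subset[OF _ assms(1)])
  ultimately have "update_count b s t \<omega> > 0" unfolding update_count_def by (auto simp: card_gt_0_iff)
  then show ?thesis using update_count_add[of t b \<omega> 0 s] assms by simp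
qed

text \<open>The running count increases strictly along the updates, and its image has the
  cardinality of the target interval. Updates are thus numbered consecutively, which turns questions
  about update times into questions about integers.\<close>

lemma bij_betw_update_count:
  assumes fin: "finite {r \<in> {0<..t}. b r \<omega> = 1}" and st: "0 \<le> s" "s \<le> t"
  shows "bij_betw (\<lambda>r. update_count b 0 r \<omega>) {r \<in> {s<..t}. b r \<omega> = 1}
    {update_count b 0 s \<omega><..update_count b 0 t \<omega>}"
proof -
  define U where "U = {r \<in> {s<..t}. b r \<omega> = 1}"
  have fin': "finite {x \<in> {0<..r}. b x \<omega> = 1}" if "r \<le> t" for r
    using that by (auto intro: finite_subset[OF _ fin])
  have less: "update_count b 0 x \<omega> < update_count b 0 y \<omega>" if "0 \<le> x" "x < y" "y \<in> U" for x y
    using that fin'[of y] by (intro update_count_less) (auto simp: U_def)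
  have inj: "inj_on (\<lambda>r. update_count b 0 r \<omega>) U"
  proof (rule inj_onI)
    fix x y assume "x \<in> U" "y \<in> U" "update_count b 0 x \<omega> = update_count b 0 y \<omega>"
    then show "x = y" using less[of x y] less[of y x] st by (cases x y rule: linorder_cases) (auto simp: U_def)
  qed
  have sub: "(\<lambda>r. update_count b 0 r \<omega>) ` U \<subseteq> {update_count b 0 s \<omega><..update_count b 0 t \<omega>}"
  proof (rule image_subsetI)
    fix r assume r: "r \<in> U"
    then have "update_count b 0 t \<omega> = update_count b 0 r \<omega> + update_count b r t \<omega>"
      using st by (intro update_count_add fin) (auto simp: U_def)
    then show "update_count b 0 r \<omega> \<in> {update_count b 0 s \<omega><..update_count b 0 t \<omega>}"
      using less[of s r] r st by (auto simp: U_def)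
  qed
  have "card ((\<lambda>r. update_count b 0 r \<omega>) ` U) = card {update_count b 0 s \<omega><..update_count b 0 t \<omega>}"
    using card_image[OF inj] update_count_add[of t b \<omega> 0 s] fin st
    by (simp add: update_count_def[of b s t] U_def)
  then have "(\<lambda>r. update_count b 0 r \<omega>) ` U = {update_count b 0 s \<omega><..update_count b 0 t \<omega>}"
    using sub by (intro card_subset_eq) auto
  then show ?thesis using inj unfolding bij_betw_def U_def by simp
qed

text \<open>Otherwise the next multiple of \<open>m\<close> after \<open>a\<close> would lie
  strictly before \<open>a + D\<close>. In the construction below this says that the age does not
  wrap around between fetches.\<close>

lemma mod_add_le_modulus:
  fixes a D m :: nat
  assumes "m > 0" "\<And>w. a < w \<Longrightarrow> w < a + D \<Longrightarrow> \<not> m dvd w"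
  shows "a mod m + D \<le> m"
proof (rule ccontr)
  assume "\<not> a mod m + D \<le> m"
  moreover have "a mod m < m" "a div m * m + a mod m = a" using assms(1) by auto
  ultimately have "a < a div m * m + m" "a div m * m + m < a + D" by linarith+
  then show False using assms(2)[of "a div m * m + m"] by simp
qed

context poisson_item
begin

text \<open>Updates do not accumulate, so one occurs at \<open>t\<close> iff every interval
  \<open>(s k, t]\<close>, with \<open>s k\<close> tending to \<open>t\<close>, contains one. This
  is a countable intersection of events in \<open>F t\<close>.\<close>

lemma update_event:
  assumes t: "t > 0"
  shows "{\<omega> \<in> space M. b t \<omega> = 1} \<in> sets (F t)"
proof -
  \<comment> \<open>The truncation at 0 keeps \<open>s k\<close> among the times for which update
    counts are known to be measurable.\<close>
  define s where "s k = max 0 (t - 1 / real (Suc k))" for k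
  have s: "0 \<le> s k" "s k < t" for k using t by (auto simp: s_def)
  have "{\<omega> \<in> space M. b t \<omega> = 1} = (\<Inter>k. {\<omega> \<in> space (F t). update_count b (s k) t \<omega> \<noteq> 0})"
  proof (intro set_eqI iffI)
    fix \<omega> assume "\<omega> \<in> {\<omega> \<in> space M. b t \<omega> = 1}"
    then have \<omega>: "\<omega> \<in> space M" "b t \<omega> = 1" by auto
    have "update_count b (s k) t \<omega> \<noteq> 0" for k
    proof -
      have "finite {r \<in> {s k<..t}. b r \<omega> = 1}"
        by (rule finite_subset[OF _ finite_updates[OF \<omega>(1), of t]]) (use s(1)[of k] in auto)
      moreover have "t \<in> {r \<in> {s k<..t}. b r \<omega> = 1}" using s(2)[of k] \<omega>(2) by simp
      ultimately show ?thesis unfolding update_count_def by (metis card_0_eq empty_iff)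
    qed
    then show "\<omega> \<in> (\<Inter>k. {\<omega> \<in> space (F t). update_count b (s k) t \<omega> \<noteq> 0})"
      using \<omega> by (simp add: space_F)
  next
    fix \<omega> assume *: "\<omega> \<in> (\<Inter>k. {\<omega> \<in> space (F t). update_count b (s k) t \<omega> \<noteq> 0})"
    then have \<omega>: "\<omega> \<in> space M" by (simp add: space_F)
    have "b t \<omega> = 1"
    proof (rule ccontr)
      assume bt: "b t \<omega> \<noteq> 1"
      define B where "B = insert 0 {r \<in> {0<..t}. b r \<omega> = 1}"
      have B: "finite B" "B \<noteq> {}" unfolding B_def using finite_updates[OF \<omega>] by auto
      have "\<forall>r\<in>B. r < t" using bt t by (auto simp: B_def less_le)
      then have "Max B < t" using B by simp
      then obtain k where k: "1 / real (Suc k) < t - Max B"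
        using nat_approx_posE[of "t - Max B"] by auto
      have "{r \<in> {s k<..t}. b r \<omega> = 1} = {}"
      proof (rule ccontr)
        assume "{r \<in> {s k<..t}. b r \<omega> = 1} \<noteq> {}"
        then obtain r where r: "s k < r" "r \<le> t" "b r \<omega> = 1" by auto
        then have "r \<in> B" using s(1)[of k] by (auto simp: B_def)
        then have "r \<le> Max B" using B by simp
        then show False using r(1) k by (simp add: s_def)
      qed
      then have "update_count b (s k) t \<omega> = 0" unfolding update_count_def by (simp only: card.empty)
      moreover have "update_count b (s k) t \<omega> \<noteq> 0" using * by blast
      ultimately show False by contradiction
    qed
    then show "\<omega> \<in> {\<omega> \<in> space M. b t \<omega> = 1}" using \<omega> by simp
  qed
  also have "\<dots> \<in> sets (F t)"
  proof (rule sets.countable_INT')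
    show "countable (UNIV :: nat set)" by simp
    show "range (\<lambda>k. {\<omega> \<in> space (F t). update_count b (s k) t \<omega> \<noteq> 0}) \<subseteq> sets (F t)"
    proof (rule image_subsetI)
      fix k
      have [measurable]: "update_count b (s k) t \<in> measurable (F t) (count_space UNIV)"
        using s[of k] by (intro update_count_measurable_F) auto
      show "{\<omega> \<in> space (F t). update_count b (s k) t \<omega> \<noteq> 0} \<in> sets (F t)" by measurable
    qed
  qed simp
  finally show ?thesis .
qed

text \<open>The policy has a closed form: updates are numbered onwards from \<open>x0\<close>, the
  age left by the decision at time 0, and a fetch occurs at each update whose number is a multiple
  of \<open>m\<close>. The residual age is then the current number modulo \<open>m\<close>.\<close>

lemma threshold_policy_exists:
  assumes m: "m > 0"
  obtains u \<Delta> where "push_item M F l b u \<Delta> d0"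
    and "\<And>t \<omega>. t \<ge> 0 \<Longrightarrow> u t \<omega> = (if \<Delta> t \<omega> \<ge> m then 1 else 0)"
proof
  define x0 where "x0 = (if d0 \<ge> m then 0 else d0)"
  define A where "A t \<omega> = update_count b 0 t \<omega>" for t and \<omega> :: 'w
  define u :: "real \<Rightarrow> 'w \<Rightarrow> nat" where
    "u t \<omega> = (if t \<le> 0 then if d0 \<ge> m then 1 else 0 else if b t \<omega> = 1 \<and> m dvd x0 + A t \<omega> then 1 else 0)" for t \<omega>
  \<comment> \<open>At a fetch time the age is still \<open>m\<close>, because the reset is visible
    only afterwards; the remainder would already be 0.\<close>
  define \<Delta> where
    "\<Delta> t \<omega> = (if t \<le> 0 then d0 else if u t \<omega> = 1 then m else (x0 + A t \<omega>) mod m)" for t \<omega>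
  have u_eq_1: "u t \<omega> = 1 \<longleftrightarrow> b t \<omega> = 1 \<and> m dvd x0 + A t \<omega>" if "t > 0" for t \<omega>
    using that by (simp add: u_def)
  have A0: "A 0 \<omega> = 0" for \<omega> by (simp add: A_def update_count_def)
  show "u t \<omega> = (if \<Delta> t \<omega> \<ge> m then 1 else 0)" if "t \<ge> 0" for t \<omega>
    using m by (auto simp: u_def \<Delta>_def not_le)
  have residual: "\<Delta> t \<omega> * (1 - u t \<omega>) = (x0 + A t \<omega>) mod m" if "t \<ge> 0" for t \<omega>
    using that m A0[of \<omega>] by (cases "t = 0") (auto simp: u_def \<Delta>_def x0_def)
  have fetch_set: "fetch_times u t \<omega> = (if d0 \<ge> m then {0} else {}) \<union> {r \<in> {r \<in> {0<..t}. b r \<omega> = 1}. m dvd x0 + A r \<omega>}"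
    if "t \<ge> 0" for t \<omega>
    using that by (auto simp: fetch_times_def u_def)
  show "push_item M F l b u \<Delta> d0"
  proof (intro push_item.intro push_item_axioms.intro)
    show "poisson_item M F l b" ..
  next
    fix \<omega> assume \<omega>: "\<omega> \<in> space M"
    have fin: "finite {r \<in> {0<..t}. b r \<omega> = 1}" for t using finite_updates[OF \<omega>] .
    have dyn: "\<Delta> t \<omega> = (x0 + A s \<omega>) mod m + update_count b s t \<omega>"
      if st: "0 \<le> s" "s < t" and nf: "\<And>r. s < r \<Longrightarrow> r < t \<Longrightarrow> u r \<omega> \<noteq> 1" for s t
    proof -
      define D where "D = update_count b s t \<omega>"
      have At: "A t \<omega> = A s \<omega> + D"
        using update_count_add[of t b \<omega> 0 s] fin[of t] st by (simp add: A_def D_def)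
      have rank: "\<exists>r. s < r \<and> r \<le> t \<and> b r \<omega> = 1 \<and> A r \<omega> = v" if "A s \<omega> < v" "v \<le> A t \<omega>" for v
      proof -
        have "v \<in> (\<lambda>r. A r \<omega>) ` {r \<in> {s<..t}. b r \<omega> = 1}"
          using bij_betw_imp_surj_on[OF bij_betw_update_count[of t b \<omega> s]] fin[of t] that st
          unfolding A_def by auto
        then show ?thesis by auto
      qed
      \<comment> \<open>An update in \<open>(s, t]\<close> numbered by a multiple of
        \<open>m\<close> is a fetch, and \<open>nf\<close> excludes fetches strictly before
        \<open>t\<close>.\<close>
      have rank_fetch: "r = t" if "s < r" "r \<le> t" "b r \<omega> = 1" "m dvd x0 + A r \<omega>" for r
      proof (rule ccontr)
        assume "r \<noteq> t"
        moreover have "u r \<omega> = 1" using that st u_eq_1[of r] by simp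
        ultimately show False using nf[of r] that by simp
      qed
      have le: "(x0 + A s \<omega>) mod m + D \<le> m"
      proof (rule mod_add_le_modulus[OF m])
        fix w assume w: "x0 + A s \<omega> < w" "w < x0 + A s \<omega> + D"
        then have "A s \<omega> < w - x0" "w - x0 \<le> A t \<omega>" using At by linarith+
        then obtain r where r: "s < r" "r \<le> t" "b r \<omega> = 1" "A r \<omega> = w - x0"
          using rank[of "w - x0"] by auto
        then have "A r \<omega> \<noteq> A t \<omega>" "x0 + A r \<omega> = w" using w At by auto
        then show "\<not> m dvd w" using rank_fetch[of r] r by auto
      qed
      have mod: "m dvd x0 + A t \<omega> \<longleftrightarrow> m dvd (x0 + A s \<omega>) mod m + D"
        unfolding At by (metis add.assoc mod_add_left_eq dvd_eq_mod_eq_0)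
      show ?thesis
      proof (cases "u t \<omega> = 1")
        case True
        then have bt: "b t \<omega> = 1" "m dvd x0 + A t \<omega>" using u_eq_1[of t \<omega>] st by auto
        have "A s \<omega> < A t \<omega>"
          unfolding A_def using fin[of t] st bt(1) by (rule update_count_less)
        then have "D > 0" using At by simp
        moreover have "m dvd (x0 + A s \<omega>) mod m + D" using mod bt(2) by blast
        ultimately have "m \<le> (x0 + A s \<omega>) mod m + D" by (intro dvd_imp_le) auto
        then show ?thesis using True le st by (simp add: \<Delta>_def D_def)
      next
        case False
        \<comment> \<open>If the sum were \<open>m\<close>, the last update up to \<open>t\<close>
          would be numbered by a multiple of \<open>m\<close>, hence occur at \<open>t\<close> and
          be a fetch, contrary to the case at hand.\<close>
        have "(x0 + A s \<omega>) mod m + D \<noteq> m"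
        proof
          assume eq: "(x0 + A s \<omega>) mod m + D = m"
          moreover have "(x0 + A s \<omega>) mod m < m" using m by simp
          ultimately have "D > 0" by linarith
          then obtain r where r: "s < r" "r \<le> t" "b r \<omega> = 1" "A r \<omega> = A t \<omega>"
            using rank[of "A t \<omega>"] At by auto
          have dvd: "m dvd x0 + A t \<omega>" unfolding mod eq by simp
          then have "r = t" using rank_fetch[of r] r by auto
          then show False using False r dvd st u_eq_1[of t \<omega>] by simp
        qed
        then have "(x0 + A s \<omega>) mod m + D < m" using le by simp
        then have "(x0 + A t \<omega>) mod m = (x0 + A s \<omega>) mod m + D"
          unfolding At by (metis add.assoc mod_add_left_eq mod_less)
        then show ?thesis using False st by (simp add: \<Delta>_def D_def)
      qed
    qed
    show "age_path b u \<Delta> d0 \<omega>"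
    proof
      show "finite {r \<in> {0<..t}. b r \<omega> = 1}" for t by (rule fin)
      show "u t \<omega> \<in> {0, 1}" if "t \<ge> 0" for t by (simp add: u_def)
      show "finite (fetch_times u t \<omega>)" if "t \<ge> 0" for t
      proof -
        have "finite {r \<in> {r \<in> {0<..t}. b r \<omega> = 1}. m dvd x0 + A r \<omega>}"
          by (rule finite_subset[OF _ fin[of t]]) auto
        then show ?thesis unfolding fetch_set[OF that] by (intro finite_UnI) auto
      qed
      show "age_dynamics b d0 u \<Delta> \<omega>"
        unfolding age_dynamics_def
      proof (intro conjI allI impI)
        show "\<Delta> 0 \<omega> = d0" by (simp add: \<Delta>_def)
        fix s t :: real assume st: "0 \<le> s \<and> s < t \<and> (\<forall>r\<in>{s<..<t}. u r \<omega> = 0)"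
        then have "u r \<omega> \<noteq> 1" if "s < r" "r < t" for r using that by auto
        then show "\<Delta> t \<omega> = \<Delta> s \<omega> * (1 - u s \<omega>) + update_count b s t \<omega>"
          using st residual[of s \<omega>] by (simp add: dyn)
      qed
    qed
  next
    fix t :: real assume t: "t \<ge> 0"
    have [measurable]: "A t \<in> measurable (F t) (count_space UNIV)"
      unfolding A_def[abs_def] using t by (intro update_count_measurable_F) auto
    show u_meas [measurable]: "u t \<in> measurable (F t) (count_space UNIV)"
    proof (cases "t = 0")
      case False
      with t have "0 < t" by simp
      have [measurable]: "Measurable.pred (F t) (\<lambda>\<omega>. b t \<omega> = 1)"
        using update_event[OF \<open>0 < t\<close>] by (simp add: pred_def space_F)
      have "u t = (\<lambda>\<omega>. if b t \<omega> = 1 \<and> m dvd x0 + A t \<omega> then 1 else 0)"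
        using \<open>0 < t\<close> by (simp add: u_def[abs_def])
      then show ?thesis by (simp only:) measurable
    qed (simp add: u_def[abs_def])
    show "\<Delta> t \<in> measurable (F t) (count_space UNIV)"
      unfolding \<Delta>_def[abs_def] by measurable
    \<comment> \<open>By the numbering, the number of fetches is a function of \<open>A t\<close>
      alone, which makes it measurable.\<close>
    have "card (fetch_times u t \<omega>) = (if d0 \<ge> m then 1 else 0) + card {v \<in> {0<..A t \<omega>}. m dvd x0 + v}"
      if \<omega>: "\<omega> \<in> space (F t)" for \<omega>
    proof -
      let ?U = "{r \<in> {0<..t}. b r \<omega> = 1}"
      have fin: "finite ?U" using \<omega> finite_updates by (simp add: space_F)
      have bij: "bij_betw (\<lambda>r. A r \<omega>) ?U {0<..A t \<omega>}"
        using bij_betw_update_count[of t b \<omega> 0] fin t by (simp add: A_def update_count_def[of b 0 0])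
      have "{v \<in> {0<..A t \<omega>}. m dvd x0 + v} = (\<lambda>r. A r \<omega>) ` {r \<in> ?U. m dvd x0 + A r \<omega>}"
        unfolding bij_betw_imp_surj_on[OF bij, symmetric] by auto
      moreover have "inj_on (\<lambda>r. A r \<omega>) {r \<in> ?U. m dvd x0 + A r \<omega>}"
        by (rule inj_on_subset[OF bij_betw_imp_inj_on[OF bij]]) auto
      ultimately have "card {v \<in> {0<..A t \<omega>}. m dvd x0 + v} = card {r \<in> ?U. m dvd x0 + A r \<omega>}"
        by (simp only: card_image)
      moreover have "card (fetch_times u t \<omega>) = card (if d0 \<ge> m then {0::real} else {}) + card {r \<in> ?U. m dvd x0 + A r \<omega>}"
        unfolding fetch_set[OF t]
      proof (rule card_Un_disjoint)
        show "finite {r \<in> ?U. m dvd x0 + A r \<omega>}" by (rule finite_subset[OF _ fin]) auto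
      qed auto
      ultimately show ?thesis by simp
    qed
    moreover have "(\<lambda>\<omega>. (if d0 \<ge> m then 1 else 0) + card {v \<in> {0<..A t \<omega>}. m dvd x0 + v})
        \<in> measurable (F t) (count_space UNIV)"
      by (rule measurable_compose[of "A t" _ "count_space UNIV"]) auto
    ultimately show "(\<lambda>\<omega>. card (fetch_times u t \<omega>)) \<in> measurable (F t) (count_space UNIV)"
      by (simp cong: measurable_cong)
  qed
qed

end

subsection \<open>The optimal push policy\<close>

lemma push_feasible_iff:
  assumes "prob_space M" "filtration (space M) F" "\<And>t. sets (F t) \<subseteq> sets M"
    and "\<And>n. n \<in> {1..N} \<Longrightarrow> lam n \<ge> 0"
    and "\<And>n. n \<in> {1..N} \<Longrightarrow> poisson_updates M F (lam n) (b n)"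
  shows "push_feasible M F N b d0 u \<Delta> \<longleftrightarrow>
    (\<forall>n\<in>{1..N}. push_item M F (lam n) (b n) (u n) (\<Delta> n) (d0 n))"
proof -
  have "push_item M F (lam n) (b n) (u n) (\<Delta> n) (d0 n) \<longleftrightarrow>
      (\<forall>\<omega>\<in>space M.
        (\<forall>t\<ge>0. u n t \<omega> \<in> {0, 1}) \<and>
        (\<forall>t\<ge>0. finite (fetch_times (u n) t \<omega>)) \<and>
        age_dynamics (b n) (d0 n) (u n) (\<Delta> n) \<omega>) \<and>
     (\<forall>t\<ge>0.
        \<Delta> n t \<in> measurable (F t) (count_space UNIV) \<and>
        u n t \<in> measurable (F t) (count_space UNIV) \<and>
        (\<lambda>\<omega>. card (fetch_times (u n) t \<omega>)) \<in> measurable (F t) (count_space UNIV))"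
    if n: "n \<in> {1..N}" for n
  proof -
    interpret poisson_item M F "lam n" "b n"
      using assms n by (simp add: poisson_item_def poisson_item_axioms_def)
    have pi: "poisson_item M F (lam n) (b n)" by unfold_locales
    show ?thesis
      using finite_updates pi unfolding push_item_def push_item_axioms_def age_path_def by blast
  qed
  then show ?thesis unfolding push_feasible_def by (intro ball_cong refl) simp
qed

lemma push_avg_cost_eq:
  assumes "\<And>n. n \<in> {1..N} \<Longrightarrow> push_item M F (lam n) (b n) (u n) (\<Delta> n) (d0 n)"
    and "\<And>n. n \<in> {1..N} \<Longrightarrow> \<beta> * p n * c_a \<ge> 0" and "T > 0"
  shows "push_avg_cost M N \<beta> p c_a c_f u \<Delta> T =
    (\<Sum>n=1..N. \<integral>\<^sup>+ \<omega>. push_item.item_cost (u n) (\<Delta> n) (\<beta> * p n * c_a) c_f T \<omega> \<partial>M) / ennreal T"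
proof -
  have "(\<integral>\<^sup>+ \<omega>. (\<Sum>n=1..N.
         ennreal (c_f * real (card (fetch_times (u n) T \<omega>)))
       + (\<integral>\<^sup>+ t. ennreal (\<beta> * p n * c_a * real (\<Delta> n t \<omega>)) * indicator {0..T} t \<partial>lborel)) \<partial>M)
    = (\<integral>\<^sup>+ \<omega>. (\<Sum>n=1..N. push_item.item_cost (u n) (\<Delta> n) (\<beta> * p n * c_a) c_f T \<omega>) \<partial>M)"
    by (intro nn_integral_cong sum.cong refl) (simp add: push_item.item_cost_def[OF assms(1)])
  also have "\<dots> = (\<Sum>n=1..N. \<integral>\<^sup>+ \<omega>. push_item.item_cost (u n) (\<Delta> n) (\<beta> * p n * c_a) c_f T \<omega> \<partial>M)"
    by (intro nn_integral_sum push_item.item_cost_meas[OF assms(1)] assms)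
  finally show ?thesis unfolding push_avg_cost_def by simp
qed

lemma ennreal_average_lower:
  fixes C e T :: real and S :: ennreal
  assumes "ennreal (C * T) \<le> S + ennreal e" "T > 0" "e \<ge> 0"
  shows "ennreal (C - e / T) \<le> S / ennreal T"
proof (cases "S = \<infinity>")
  case True
  then show ?thesis using assms by (simp add: ennreal_top_divide top.not_eq_extremum)
next
  case False
  then obtain x where x: "S = ennreal x" "x \<ge> 0" by (cases S) auto
  then have "C * T \<le> x + e" using assms by (simp add: ennreal_plus[symmetric] ennreal_le_iff del: ennreal_plus)
  then have "(C * T - e) / T \<le> x / T" using assms by (intro divide_right_mono) auto
  then have "C - e / T \<le> x / T" using assms by (simp add: diff_divide_distrib)
  then show ?thesis using x assms by (simp add: divide_ennreal ennreal_leI)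
qed

theorem theorem1:
  fixes M :: "'w measure" and F :: "real \<Rightarrow> 'w measure"
    and N :: nat and b :: "nat \<Rightarrow> real \<Rightarrow> 'w \<Rightarrow> nat" and d0 :: "nat \<Rightarrow> nat"
    and \<beta> c_a c_f :: real and p lam :: "nat \<Rightarrow> real" and \<eta> :: "nat \<Rightarrow> nat"
  assumes "prob_space M"
    and "filtration (space M) F" and "\<And>t. sets (F t) \<subseteq> sets M"
    and "\<And>n. n \<in> {1..N} \<Longrightarrow> lam n \<ge> 0"
    and "\<And>n. n \<in> {1..N} \<Longrightarrow> poisson_updates M F (lam n) (b n)"
    and "\<beta> \<ge> 0" and "c_a \<ge> 0" and "c_f > 0"
    and "\<And>n. n \<in> {1..N} \<Longrightarrow> p n \<ge> 0" and "(\<Sum>n=1..N. p n) = 1"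
    and "\<And>n. n \<in> {1..N} \<Longrightarrow> \<beta> * p n * c_a \<noteq> 0"
    and "\<And>n. n \<in> {1..N} \<Longrightarrow> is_eta_star (lam n) (\<beta> * p n * c_a) c_f (\<eta> n)"
  shows "(\<exists>u \<Delta>. push_feasible M F N b d0 u \<Delta> \<and> follows_threshold M N \<eta> u \<Delta>) \<and>
    (\<forall>u \<Delta>. push_feasible M F N b d0 u \<Delta> \<and> follows_threshold M N \<eta> u \<Delta> \<longrightarrow>
       push_solution M F N b d0 \<beta> p c_a c_f u \<Delta>
         (\<Sum>n=1..N. c_B (lam n) (\<beta> * p n * c_a) c_f (\<eta> n))) \<and>
    ((\<forall>n\<in>{1..N}. lam n > 0 \<and> sqrt (2 * lam n * c_f / (\<beta> * p n * c_a)) \<in> \<int>) \<longrightarrow>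
       (\<Sum>n=1..N. c_B (lam n) (\<beta> * p n * c_a) c_f (\<eta> n))
         = (\<Sum>n=1..N. sqrt (2 * lam n * \<beta> * p n * c_a * c_f) - 1/2 * \<beta> * p n * c_a))"
proof (intro conjI allI impI)
  define h where "h n = \<beta> * p n * c_a" for n
  define C where "C n = c_B (lam n) (h n) c_f (\<eta> n)" for n
  have h: "h n > 0" if "n \<in> {1..N}" for n
    unfolding h_def using assms(6,7) assms(9)[OF that] assms(11)[OF that] by (simp add: less_le)
  have eta: "is_eta_star (lam n) (h n) c_f (\<eta> n)" if "n \<in> {1..N}" for n
    using assms(12)[OF that] by (simp add: h_def)
  have C: "C n \<ge> 0" if "n \<in> {1..N}" for n
    unfolding C_def using assms(4,8) that h is_eta_star_pos[OF eta] by (intro c_B_nonneg) auto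
  have feasible: "push_feasible M F N b d0 u \<Delta> \<longleftrightarrow>
      (\<forall>n\<in>{1..N}. push_item M F (lam n) (b n) (u n) (\<Delta> n) (d0 n))" for u \<Delta>
    by (rule push_feasible_iff) (use assms in auto)
  let ?cost = "\<lambda>u \<Delta>. push_avg_cost M N \<beta> p c_a c_f u \<Delta>"
  have cost: "?cost u \<Delta> T = (\<Sum>n=1..N. \<integral>\<^sup>+ \<omega>. push_item.item_cost (u n) (\<Delta> n) (h n) c_f T \<omega> \<partial>M) / ennreal T"
    if "push_feasible M F N b d0 u \<Delta>" "T > 0" for u \<Delta> T
    using that h unfolding h_def feasible by (intro push_avg_cost_eq) (auto simp: less_imp_le)
  \<comment> \<open>Each item contributes a slack of \<open>c_f\<close>, and after division by
    \<open>T\<close> the total slack tends to 0.\<close>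
  have lower: "ennreal (sum C {1..N} - real N * c_f / T) \<le> ?cost u \<Delta> T"
    if f: "push_feasible M F N b d0 u \<Delta>" and T: "T > 0" for u \<Delta> T
  proof -
    let ?S = "\<lambda>n. \<integral>\<^sup>+ \<omega>. push_item.item_cost (u n) (\<Delta> n) (h n) c_f T \<omega> \<partial>M"
    have "ennreal (sum C {1..N} * T) = (\<Sum>n=1..N. ennreal (C n * T))"
      unfolding sum_distrib_right using C T by (intro sum_ennreal[symmetric]) auto
    also have "\<dots> \<le> (\<Sum>n=1..N. ?S n + ennreal c_f)"
    proof (rule sum_mono)
      fix n assume n: "n \<in> {1..N}"
      then have "push_item M F (lam n) (b n) (u n) (\<Delta> n) (d0 n)" using f feasible by blast
      then show "ennreal (C n * T) \<le> ?S n + ennreal c_f"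
        unfolding C_def using eta[OF n] h[OF n] assms(8) T by (rule push_item.item_cost_lower_bound)
    qed
    also have "\<dots> = (\<Sum>n=1..N. ?S n) + ennreal (real N * c_f)"
      using assms(8) by (simp add: sum.distrib ennreal_mult ennreal_of_nat_eq_real_of_nat)
    finally show ?thesis unfolding cost[OF f T] using assms(8) T by (intro ennreal_average_lower) auto
  qed
  have vanish: "((\<lambda>T. a + k / T) \<longlongrightarrow> a) at_top" for a k :: real
    by real_asymp
  have lower_tendsto: "((\<lambda>T. ennreal (sum C {1..N} - real N * c_f / T)) \<longlongrightarrow> ennreal (sum C {1..N})) at_top"
  proof (rule tendsto_ennrealI)
    show "((\<lambda>T. sum C {1..N} - real N * c_f / T) \<longlongrightarrow> sum C {1..N}) at_top"
      using vanish[of "sum C {1..N}" "- (real N * c_f)"] by simp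
  qed
  {
    have "\<exists>u \<Delta>. push_item M F (lam n) (b n) u \<Delta> (d0 n) \<and>
        (\<forall>t\<ge>0. \<forall>\<omega>. u t \<omega> = (if \<Delta> t \<omega> \<ge> \<eta> n then 1 else 0))" if n: "n \<in> {1..N}" for n
    proof -
      interpret poisson_item M F "lam n" "b n"
        using assms n by (simp add: poisson_item_def poisson_item_axioms_def)
      show ?thesis by (rule threshold_policy_exists[OF is_eta_star_pos[OF eta[OF n]]]) blast
    qed
    \<comment> \<open>Feasibility and the threshold law are conditions on each item separately, so
      policies chosen item by item combine into one.\<close>
    then obtain u \<Delta> where "\<forall>n\<in>{1..N}. push_item M F (lam n) (b n) (u n) (\<Delta> n) (d0 n) \<and>
        (\<forall>t\<ge>0. \<forall>\<omega>. u n t \<omega> = (if \<Delta> n t \<omega> \<ge> \<eta> n then 1 else 0))" by metis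
    then show "\<exists>u \<Delta>. push_feasible M F N b d0 u \<Delta> \<and> follows_threshold M N \<eta> u \<Delta>"
      unfolding feasible follows_threshold_def by blast
  }
  {
    fix u \<Delta> assume "push_feasible M F N b d0 u \<Delta> \<and> follows_threshold M N \<eta> u \<Delta>"
    then have f: "push_feasible M F N b d0 u \<Delta>" and thr: "follows_threshold M N \<eta> u \<Delta>" by auto
    \<comment> \<open>Together with \<open>lower\<close> this squeezes the average cost of the
      threshold policy, so it converges; for the competitors \<open>lower\<close> alone bounds the
      lower limit.\<close>
    have upper: "?cost u \<Delta> T \<le> ennreal (sum C {1..N} + real N * (2 * c_f) / T)" if T: "T > 0" for T
    proof -
      let ?S = "\<lambda>n. \<integral>\<^sup>+ \<omega>. push_item.item_cost (u n) (\<Delta> n) (h n) c_f T \<omega> \<partial>M"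
      have "(\<Sum>n=1..N. ?S n) \<le> (\<Sum>n=1..N. ennreal (C n * T + 2 * c_f))"
      proof (rule sum_mono)
        fix n assume n: "n \<in> {1..N}"
        then have "push_item M F (lam n) (b n) (u n) (\<Delta> n) (d0 n)" using f feasible by blast
        then show "?S n \<le> ennreal (C n * T + 2 * c_f)"
          unfolding C_def using eta[OF n] h[OF n] assms(8) T
        proof (rule push_item.threshold_cost_upper_bound)
          fix t :: real and \<omega> assume "0 \<le> t" "\<omega> \<in> space M"
          then show "u n t \<omega> = (if \<eta> n \<le> \<Delta> n t \<omega> then 1 else 0)"
            using thr n unfolding follows_threshold_def by blast
        qed
      qed
      also have "\<dots> = ennreal (sum C {1..N} * T + real N * (2 * c_f))"
        using C T assms(8) by (subst sum_ennreal) (auto simp: sum.distrib sum_distrib_right)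
      finally have "(\<Sum>n=1..N. ?S n) / ennreal T \<le> ennreal (sum C {1..N} * T + real N * (2 * c_f)) / ennreal T"
        by (rule divide_right_mono_ennreal)
      also have "\<dots> = ennreal ((sum C {1..N} * T + real N * (2 * c_f)) / T)"
        using T assms(8) C by (intro divide_ennreal add_nonneg_nonneg mult_nonneg_nonneg sum_nonneg) auto
      also have "(sum C {1..N} * T + real N * (2 * c_f)) / T = sum C {1..N} + real N * (2 * c_f) / T"
        using T by (simp add: add_divide_distrib)
      finally show ?thesis unfolding cost[OF f T] .
    qed
    have upper_tendsto: "((\<lambda>T. ennreal (sum C {1..N} + real N * (2 * c_f) / T)) \<longlongrightarrow> ennreal (sum C {1..N})) at_top"
    proof (rule tendsto_ennrealI)
      show "((\<lambda>T. sum C {1..N} + real N * (2 * c_f) / T) \<longlongrightarrow> sum C {1..N}) at_top" by (rule vanish)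
    qed
    have "(?cost u \<Delta> \<longlongrightarrow> ennreal (sum C {1..N})) at_top"
      by (rule tendsto_sandwich[OF eventually_mono[OF eventually_gt_at_top[of 0] lower[OF f]]
            eventually_mono[OF eventually_gt_at_top[of 0] upper] lower_tendsto upper_tendsto])
    moreover have "ennreal (sum C {1..N}) \<le> Liminf at_top (?cost u' \<Delta>')"
      if f': "push_feasible M F N b d0 u' \<Delta>'" for u' \<Delta>'
    proof -
      have "ennreal (sum C {1..N}) = Liminf at_top (\<lambda>T. ennreal (sum C {1..N} - real N * c_f / T))"
        by (rule lim_imp_Liminf[OF _ lower_tendsto, symmetric]) simp
      also have "\<dots> \<le> Liminf at_top (?cost u' \<Delta>')"
        by (intro Liminf_mono eventually_mono[OF eventually_gt_at_top[of 0]] lower[OF f'])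
      finally show ?thesis .
    qed
    ultimately show "push_solution M F N b d0 \<beta> p c_a c_f u \<Delta>
        (\<Sum>n=1..N. c_B (lam n) (\<beta> * p n * c_a) c_f (\<eta> n))"
      using f unfolding push_solution_def C_def h_def by blast
  }
  {
    assume int: "\<forall>n\<in>{1..N}. lam n > 0 \<and> sqrt (2 * lam n * c_f / (\<beta> * p n * c_a)) \<in> \<int>"
    show "(\<Sum>n=1..N. c_B (lam n) (\<beta> * p n * c_a) c_f (\<eta> n))
         = (\<Sum>n=1..N. sqrt (2 * lam n * \<beta> * p n * c_a * c_f) - 1/2 * \<beta> * p n * c_a)"
    proof (rule sum.cong[OF refl])
      fix n assume n: "n \<in> {1..N}"
      have "c_B (lam n) (h n) c_f (\<eta> n) = sqrt (2 * lam n * h n * c_f) - 1/2 * h n"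
        using int n assms(8) h eta by (intro c_B_integer_sqrt) (auto simp: h_def)
      then show "c_B (lam n) (\<beta> * p n * c_a) c_f (\<eta> n)
          = sqrt (2 * lam n * \<beta> * p n * c_a * c_f) - 1/2 * \<beta> * p n * c_a"
        by (simp add: h_def mult.assoc)
    qed
  }
qed

end
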